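(* $\mathcal{BBD} \equiv \mathcal{FO}(\mathcal{POC}^+)$: for every relational vocabulary $\tau$, every sentence of bounded Boolean dependence logic $\mathcal{BBD}(\tau)$ is equivalent (true in exactly the same $\tau$-structures) to some sentence of $\mathcal{FO}(\mathcal{POC}^+)(\tau)$, and every sentence of $\mathcal{FO}(\mathcal{POC}^+)(\tau)$ is equivalent to some sentence of $\mathcal{BBD}(\tau)$.
   Context: Boolean dependence logic $\mathcal{BD}$. There are first-order variables $x,y,z,\dots$ and Boolean variables $\alpha,\beta,\dots$. For a relational vocabulary $\tau$, $\mathcal{BD}(\tau)$-formulas are generated by $\varphi ::= x_1=x_2 \mid \neg x_1=x_2 \mid \alpha \mid \neg\alpha \mid =(x_1,\dots,x_n,\alpha) \mid R(x_1,\dots,x_n)\mid \neg R(x_1,\dots,x_n) \mid (\varphi\vee\varphi)\mid(\varphi\wedge\varphi)\mid \forall x\varphi\mid\exists x\varphi\mid\exists\alpha\varphi$ ($R\in\tau$; $x_i$ first-order variables). Atoms $=(x_1,\dots,x_n,\alpha)$ are Boolean dependence atoms. Free variables are defined as usual ($\exists\alpha$ binds $\alpha$). Semantics is team semantics: an assignment over a structure $\mathfrak A$ maps finitely many first-order variables into $A$ and Boolean variables into $\{\perp,\top\}$ (assumed disjoint from $A$); a team $X$ is a set of assignments with a common domain. $\mathfrak A\models_X$: a first-order literal iff every $s\in X$ satisfies it classically; $\alpha$ iff $s(\alpha)=\top$ for all $s\in X$; $\neg\alpha$ iff $s(\alpha)=\perp$ for all $s\in X$; $=(x_1,\dots,x_n,\alpha)$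 iff any $s,t\in X$ agreeing on $x_1,\dots,x_n$ satisfy $s(\alpha)=t(\alpha)$; $\varphi\wedge\psi$ iff both hold in $X$; $\varphi\vee\psi$ iff $X=Y\cup Z$ with $\mathfrak A\models_Y\varphi$, $\mathfrak A\models_Z\psi$; $\exists x\psi$ iff $\mathfrak A\models_{\{s(F(s)/x):s\in X\}}\psi$ for some $F:X\to A$; $\exists\alpha\psi$ iff $\mathfrak A\models_{\{s(F(s)/\alpha):s\in X\}}\psi$ for some $F:X\to\{\perp,\top\}$; $\forall x\psi$ iff $\mathfrak A\models_{\{s(a/x):s\in X,a\in A\}}\psi$. A sentence (no free variables) $\varphi$ is true in $\mathfrak A$ iff $\mathfrak A\models_{\{\emptyset\}}\varphi$. Bounded fragment $\mathcal{BBD}$. For an occurrence $o$ of a subformula of $\varphi$, let $V(o)$ be the set of first-order variables $x$ that are free in $\varphi$ or such that $o$ lies in the scope of a quantifier $\forall x$ or $\exists x$ in $\varphi$. $\mathcal{BBD}$ consists of the $\mathcal{BD}$-formulas $\varphi$ such that whenever $\exists x\psi$ occurs in $\varphi$ and a dependence atom $=(x_1,\dots,x_n,\alpha)$ is a subformula of that $\psi$, then $V(o)\subseteq\{x_1,\dots,x_n\}$ where $o$ is the occurrence of $\psi$ inside that occurrence of $\exists x\psi$. Partially-ordered connectives. If $\vec x_i=(x_{i1},\dots,x_{in_i})$ ($1\le i\le m$) are tuples of first-order variables (variables may repeat) and $\alpha_1,\dots,\alpha_m$ are distinct Boolean variables, the connective $N_\pi\vec x_1\alpha_1\dots\vec x_m\alpha_m$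 has pattern $\pi=(n_1,\dots,n_m,E)$ where $E=\{(i,j,k,l): x_{ij}=x_{kl}\}$. A tuple $\vec a_1\dots\vec a_m$ with $\vec a_i\in A^{n_i}$ is of pattern $\pi$ if $a_{ij}=a_{kl}$ whenever $(i,j,k,l)\in E$. Semantics (Tarskian, single assignments $s$): $\mathfrak A,s\models N_\pi\vec x_1\alpha_1\dots\vec x_m\alpha_m\varphi$ iff there are $f_i:A^{n_i}\to\{\perp,\top\}$ such that for all $\vec a_1\dots\vec a_m$ of pattern $\pi$, $\mathfrak A,s(\vec a_1/\vec x_1,\dots,\vec a_m/\vec x_m,f_1(\vec a_1)/\alpha_1,\dots,f_m(\vec a_m)/\alpha_m)\models\varphi$. $\mathcal{FO}(\mathcal{POC}^+)(\tau)$ is generated by $\varphi::=\alpha\mid\neg\alpha\mid x_1=x_2\mid\neg x_1=x_2\mid R(\vec x)\mid\neg R(\vec x)\mid(\varphi\vee\varphi)\mid(\varphi\wedge\varphi)\mid\forall x\varphi\mid\exists x\varphi\mid N_\pi\vec x_1\alpha_1\dots\vec x_m\alpha_m\varphi$, with the usual classical semantics for the other clauses ($\alpha$ true iff $s(\alpha)=\top$). Sentences have no free first-order or Boolean variables.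
   Formalization: BBD is read up to renaming bound variables: members of V(o) must have distinct names and not be re-quantified before the atom (by names only, a BBD sentence expresses evenness, which FO(POC+) cannot). The equivalent sentence is found per carrier type; uniformity follows by cardinality. *)

theory Defs
  imports Main
begin

section \<open>Vocabularies, structures, assignments\<close>

type_synonym fovar = nat
type_synonym bvar = nat

text \<open>A relational vocabulary is a partial map from relation symbols to arities.\<close>

type_synonym 'r vocabulary = "'r \<rightharpoonup> nat"

record ('r, 'a) struct =
  univ :: "'a set"
  interp :: "'r \<Rightarrow> 'a list set"

definition is_structure :: "'r vocabulary \<Rightarrow> ('r, 'a) struct \<Rightarrow> bool" where
  "is_structure \<tau> M \<longleftrightarrow> univ M \<noteq> {} \<and>
     (\<forall>R n. \<tau> R = Some n \<longrightarrow> interp M R \<subseteq> {as. length as = n \<and> set as \<subseteq> univ M})"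

text \<open>An assignment has a first-order part and a Boolean part; \<open>True\<close> and \<open>False\<close> play
  the roles of top and bottom.\<close>

type_synonym 'a assignment = "(fovar \<rightharpoonup> 'a) \<times> (bvar \<rightharpoonup> bool)"
type_synonym 'a team = "'a assignment set"

definition empty_assignment :: "'a assignment" where
  "empty_assignment = (Map.empty, Map.empty)"

definition upd_fo :: "'a assignment \<Rightarrow> fovar \<Rightarrow> 'a \<Rightarrow> 'a assignment" where
  "upd_fo s x a = ((fst s)(x \<mapsto> a), snd s)"

definition upd_bool :: "'a assignment \<Rightarrow> bvar \<Rightarrow> bool \<Rightarrow> 'a assignment" where
  "upd_bool s \<alpha> b = (fst s, (snd s)(\<alpha> \<mapsto> b))"

definition fo_val :: "'a assignment \<Rightarrow> fovar \<Rightarrow> 'a" where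
  "fo_val s x = the (fst s x)"

definition bool_val :: "'a assignment \<Rightarrow> bvar \<Rightarrow> bool" where
  "bool_val s \<alpha> = the (snd s \<alpha>)"


section \<open>Boolean dependence logic\<close>

datatype 'r bd =
    DEq fovar fovar
  | DNeq fovar fovar
  | DBool bvar
  | DNBool bvar
  | DDep "fovar list" bvar
  | DRel 'r "fovar list"
  | DNRel 'r "fovar list"
  | DOr "'r bd" "'r bd"
  | DAnd "'r bd" "'r bd"
  | DAll fovar "'r bd"
  | DEx fovar "'r bd"
  | DExB bvar "'r bd"

primrec bd_formula :: "'r vocabulary \<Rightarrow> 'r bd \<Rightarrow> bool" where
  "bd_formula \<tau> (DEq x y) \<longleftrightarrow> True"
| "bd_formula \<tau> (DNeq x y) \<longleftrightarrow> True"
| "bd_formula \<tau> (DBool \<alpha>) \<longleftrightarrow> True"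
| "bd_formula \<tau> (DNBool \<alpha>) \<longleftrightarrow> True"
| "bd_formula \<tau> (DDep xs \<alpha>) \<longleftrightarrow> True"
| "bd_formula \<tau> (DRel R xs) \<longleftrightarrow> \<tau> R = Some (length xs)"
| "bd_formula \<tau> (DNRel R xs) \<longleftrightarrow> \<tau> R = Some (length xs)"
| "bd_formula \<tau> (DOr \<phi> \<psi>) \<longleftrightarrow> bd_formula \<tau> \<phi> \<and> bd_formula \<tau> \<psi>"
| "bd_formula \<tau> (DAnd \<phi> \<psi>) \<longleftrightarrow> bd_formula \<tau> \<phi> \<and> bd_formula \<tau> \<psi>"
| "bd_formula \<tau> (DAll x \<phi>) \<longleftrightarrow> bd_formula \<tau> \<phi>"
| "bd_formula \<tau> (DEx x \<phi>) \<longleftrightarrow> bd_formula \<tau> \<phi>"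
| "bd_formula \<tau> (DExB \<alpha> \<phi>) \<longleftrightarrow> bd_formula \<tau> \<phi>"

primrec bd_free_fo :: "'r bd \<Rightarrow> fovar set" where
  "bd_free_fo (DEq x y) = {x, y}"
| "bd_free_fo (DNeq x y) = {x, y}"
| "bd_free_fo (DBool \<alpha>) = {}"
| "bd_free_fo (DNBool \<alpha>) = {}"
| "bd_free_fo (DDep xs \<alpha>) = set xs"
| "bd_free_fo (DRel R xs) = set xs"
| "bd_free_fo (DNRel R xs) = set xs"
| "bd_free_fo (DOr \<phi> \<psi>) = bd_free_fo \<phi> \<union> bd_free_fo \<psi>"
| "bd_free_fo (DAnd \<phi> \<psi>) = bd_free_fo \<phi> \<union> bd_free_fo \<psi>"
| "bd_free_fo (DAll x \<phi>) = bd_free_fo \<phi> - {x}"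
| "bd_free_fo (DEx x \<phi>) = bd_free_fo \<phi> - {x}"
| "bd_free_fo (DExB \<alpha> \<phi>) = bd_free_fo \<phi>"

primrec bd_free_bool :: "'r bd \<Rightarrow> bvar set" where
  "bd_free_bool (DEq x y) = {}"
| "bd_free_bool (DNeq x y) = {}"
| "bd_free_bool (DBool \<alpha>) = {\<alpha>}"
| "bd_free_bool (DNBool \<alpha>) = {\<alpha>}"
| "bd_free_bool (DDep xs \<alpha>) = {\<alpha>}"
| "bd_free_bool (DRel R xs) = {}"
| "bd_free_bool (DNRel R xs) = {}"
| "bd_free_bool (DOr \<phi> \<psi>) = bd_free_bool \<phi> \<union> bd_free_bool \<psi>"
| "bd_free_bool (DAnd \<phi> \<psi>) = bd_free_bool \<phi> \<union> bd_free_bool \<psi>"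
| "bd_free_bool (DAll x \<phi>) = bd_free_bool \<phi>"
| "bd_free_bool (DEx x \<phi>) = bd_free_bool \<phi>"
| "bd_free_bool (DExB \<alpha> \<phi>) = bd_free_bool \<phi> - {\<alpha>}"

primrec bd_sat :: "('r, 'a) struct \<Rightarrow> 'r bd \<Rightarrow> 'a team \<Rightarrow> bool" where
  "bd_sat M (DEq x y) X \<longleftrightarrow> (\<forall>s\<in>X. fo_val s x = fo_val s y)"
| "bd_sat M (DNeq x y) X \<longleftrightarrow> (\<forall>s\<in>X. fo_val s x \<noteq> fo_val s y)"
| "bd_sat M (DBool \<alpha>) X \<longleftrightarrow> (\<forall>s\<in>X. bool_val s \<alpha> = True)"
| "bd_sat M (DNBool \<alpha>) X \<longleftrightarrow> (\<forall>s\<in>X. bool_val s \<alpha> = False)"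
| "bd_sat M (DDep xs \<alpha>) X \<longleftrightarrow>
     (\<forall>s\<in>X. \<forall>t\<in>X. (\<forall>x\<in>set xs. fo_val s x = fo_val t x) \<longrightarrow> bool_val s \<alpha> = bool_val t \<alpha>)"
| "bd_sat M (DRel R xs) X \<longleftrightarrow> (\<forall>s\<in>X. map (fo_val s) xs \<in> interp M R)"
| "bd_sat M (DNRel R xs) X \<longleftrightarrow> (\<forall>s\<in>X. map (fo_val s) xs \<notin> interp M R)"
| "bd_sat M (DOr \<phi> \<psi>) X \<longleftrightarrow> (\<exists>Y Z. X = Y \<union> Z \<and> bd_sat M \<phi> Y \<and> bd_sat M \<psi> Z)"
| "bd_sat M (DAnd \<phi> \<psi>) X \<longleftrightarrow> bd_sat M \<phi> X \<and> bd_sat M \<psi> X"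
| "bd_sat M (DAll x \<phi>) X \<longleftrightarrow> bd_sat M \<phi> {upd_fo s x a | s a. s \<in> X \<and> a \<in> univ M}"
| "bd_sat M (DEx x \<phi>) X \<longleftrightarrow>
     (\<exists>F. (\<forall>s\<in>X. F s \<in> univ M) \<and> bd_sat M \<phi> {upd_fo s x (F s) | s. s \<in> X})"
| "bd_sat M (DExB \<alpha> \<phi>) X \<longleftrightarrow>
     (\<exists>F. bd_sat M \<phi> {upd_bool s \<alpha> (F s) | s. s \<in> X})"

definition bd_sentence :: "'r vocabulary \<Rightarrow> 'r bd \<Rightarrow> bool" where
  "bd_sentence \<tau> \<phi> \<longleftrightarrow> bd_formula \<tau> \<phi> \<and> bd_free_fo \<phi> = {} \<and> bd_free_bool \<phi> = {}"

definition bd_true :: "('r, 'a) struct \<Rightarrow> 'r bd \<Rightarrow> bool" where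
  "bd_true M \<phi> \<longleftrightarrow> bd_sat M \<phi> {empty_assignment}"


section \<open>The bounded fragment\<close>

text \<open>For each occurrence in \<open>\<psi>\<close> of a dependence atom with first-order arguments \<open>xs\<close>, the set
  contains \<open>(D, xs)\<close>, where \<open>D\<close> consists of the first-order variables quantified within \<open>\<psi>\<close>
  above that occurrence.\<close>

primrec dep_atoms :: "'r bd \<Rightarrow> (fovar set \<times> fovar list) set" where
  "dep_atoms (DEq x y) = {}"
| "dep_atoms (DNeq x y) = {}"
| "dep_atoms (DBool \<alpha>) = {}"
| "dep_atoms (DNBool \<alpha>) = {}"
| "dep_atoms (DDep xs \<alpha>) = {({}, xs)}"
| "dep_atoms (DRel R xs) = {}"
| "dep_atoms (DNRel R xs) = {}"
| "dep_atoms (DOr \<phi> \<psi>) = dep_atoms \<phi> \<union> dep_atoms \<psi>"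
| "dep_atoms (DAnd \<phi> \<psi>) = dep_atoms \<phi> \<union> dep_atoms \<psi>"
| "dep_atoms (DAll x \<phi>) = {(insert x D, xs) | D xs. (D, xs) \<in> dep_atoms \<phi>}"
| "dep_atoms (DEx x \<phi>) = {(insert x D, xs) | D xs. (D, xs) \<in> dep_atoms \<phi>}"
| "dep_atoms (DExB \<alpha> \<phi>) = dep_atoms \<phi>"

text \<open>The list \<open>G\<close> enumerates the free first-order variables of the whole formula and the
  first-order quantifiers in whose scope the current occurrence lies. At an occurrence \<open>o\<close> of
  \<open>\<psi>\<close> inside \<open>\<exists>x\<psi>\<close>, the set \<open>V(o)\<close> is \<open>set (x # G)\<close>, and the boundedness condition is
  \<open>set (x # G) \<subseteq> set xs\<close>. It speaks about variables, not about their names: the members of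
  \<open>V(o)\<close> occurring in the atom have to be bound there by the same quantifiers as at \<open>o\<close>, so that
  renaming bound variables does not affect membership in the fragment. This is what the other two
  conjuncts say: no two members of \<open>V(o)\<close> share a name, and none of them is quantified again
  between \<open>o\<close> and the atom. They are vacuous for formulas in which no first-order
  variable that is free or already in scope is quantified again. Without them the fragment would
  be strictly larger, even up to equivalence: in
  \<open>\<forall>y\<exists>x\<forall>y\<exists>\<alpha>(=(x,y,\<alpha>) \<and> \<dots>)\<close> the value of \<open>\<alpha>\<close> would not be allowed to depend on the
  \<open>y\<close> that was used for choosing \<open>x\<close>.\<close>

primrec bounded :: "fovar list \<Rightarrow> 'r bd \<Rightarrow> bool" where
  "bounded G (DEq x y) \<longleftrightarrow> True"
| "bounded G (DNeq x y) \<longleftrightarrow> True"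
| "bounded G (DBool \<alpha>) \<longleftrightarrow> True"
| "bounded G (DNBool \<alpha>) \<longleftrightarrow> True"
| "bounded G (DDep xs \<alpha>) \<longleftrightarrow> True"
| "bounded G (DRel R xs) \<longleftrightarrow> True"
| "bounded G (DNRel R xs) \<longleftrightarrow> True"
| "bounded G (DOr \<phi> \<psi>) \<longleftrightarrow> bounded G \<phi> \<and> bounded G \<psi>"
| "bounded G (DAnd \<phi> \<psi>) \<longleftrightarrow> bounded G \<phi> \<and> bounded G \<psi>"
| "bounded G (DAll x \<psi>) \<longleftrightarrow> bounded (x # G) \<psi>"
| "bounded G (DEx x \<psi>) \<longleftrightarrow>
     (\<forall>(D, xs) \<in> dep_atoms \<psi>.
        set (x # G) \<subseteq> set xs \<and> distinct (x # G) \<and> set (x # G) \<inter> D = {}) \<and>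
     bounded (x # G) \<psi>"
| "bounded G (DExB \<alpha> \<psi>) \<longleftrightarrow> bounded G \<psi>"

definition bbd_formula :: "'r vocabulary \<Rightarrow> 'r bd \<Rightarrow> bool" where
  "bbd_formula \<tau> \<phi> \<longleftrightarrow>
     bd_formula \<tau> \<phi> \<and> bounded (sorted_list_of_set (bd_free_fo \<phi>)) \<phi>"

definition bbd_sentence :: "'r vocabulary \<Rightarrow> 'r bd \<Rightarrow> bool" where
  "bbd_sentence \<tau> \<phi> \<longleftrightarrow> bbd_formula \<tau> \<phi> \<and> bd_sentence \<tau> \<phi>"


section \<open>First-order logic with positive partially-ordered connectives\<close>

text \<open>\<open>PPoc [(xs\<^sub>1, \<alpha>\<^sub>1), \<dots>, (xs\<^sub>m, \<alpha>\<^sub>m)] \<phi>\<close> stands for the connective applied to \<open>\<phi>\<close>; its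
  pattern is determined by the tuples \<open>xs\<^sub>i\<close>.\<close>

datatype 'r poc =
    PBool bvar
  | PNBool bvar
  | PEq fovar fovar
  | PNeq fovar fovar
  | PRel 'r "fovar list"
  | PNRel 'r "fovar list"
  | POr "'r poc" "'r poc"
  | PAnd "'r poc" "'r poc"
  | PAll fovar "'r poc"
  | PEx fovar "'r poc"
  | PPoc "(fovar list \<times> bvar) list" "'r poc"

text \<open>Positions in tuples are counted from 0.\<close>

definition pattern :: "fovar list list \<Rightarrow> nat list \<times> (nat \<times> nat \<times> nat \<times> nat) set" where
  "pattern xss = (map length xss,
     {(i, j, k, l). i < length xss \<and> j < length (xss ! i) \<and>
                    k < length xss \<and> l < length (xss ! k) \<and> xss ! i ! j = xss ! k ! l})"

definition of_pattern ::
    "'a set \<Rightarrow> nat list \<times> (nat \<times> nat \<times> nat \<times> nat) set \<Rightarrow> 'a list list \<Rightarrow> bool" where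
  "of_pattern A \<pi> ass \<longleftrightarrow>
     map length ass = fst \<pi> \<and> (\<forall>as\<in>set ass. set as \<subseteq> A) \<and>
     (\<forall>(i, j, k, l) \<in> snd \<pi>. ass ! i ! j = ass ! k ! l)"

primrec poc_formula :: "'r vocabulary \<Rightarrow> 'r poc \<Rightarrow> bool" where
  "poc_formula \<tau> (PBool \<alpha>) \<longleftrightarrow> True"
| "poc_formula \<tau> (PNBool \<alpha>) \<longleftrightarrow> True"
| "poc_formula \<tau> (PEq x y) \<longleftrightarrow> True"
| "poc_formula \<tau> (PNeq x y) \<longleftrightarrow> True"
| "poc_formula \<tau> (PRel R xs) \<longleftrightarrow> \<tau> R = Some (length xs)"
| "poc_formula \<tau> (PNRel R xs) \<longleftrightarrow> \<tau> R = Some (length xs)"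
| "poc_formula \<tau> (POr \<phi> \<psi>) \<longleftrightarrow> poc_formula \<tau> \<phi> \<and> poc_formula \<tau> \<psi>"
| "poc_formula \<tau> (PAnd \<phi> \<psi>) \<longleftrightarrow> poc_formula \<tau> \<phi> \<and> poc_formula \<tau> \<psi>"
| "poc_formula \<tau> (PAll x \<phi>) \<longleftrightarrow> poc_formula \<tau> \<phi>"
| "poc_formula \<tau> (PEx x \<phi>) \<longleftrightarrow> poc_formula \<tau> \<phi>"
| "poc_formula \<tau> (PPoc ts \<phi>) \<longleftrightarrow> ts \<noteq> [] \<and> distinct (map snd ts) \<and> poc_formula \<tau> \<phi>"

primrec poc_free_fo :: "'r poc \<Rightarrow> fovar set" where
  "poc_free_fo (PBool \<alpha>) = {}"
| "poc_free_fo (PNBool \<alpha>) = {}"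
| "poc_free_fo (PEq x y) = {x, y}"
| "poc_free_fo (PNeq x y) = {x, y}"
| "poc_free_fo (PRel R xs) = set xs"
| "poc_free_fo (PNRel R xs) = set xs"
| "poc_free_fo (POr \<phi> \<psi>) = poc_free_fo \<phi> \<union> poc_free_fo \<psi>"
| "poc_free_fo (PAnd \<phi> \<psi>) = poc_free_fo \<phi> \<union> poc_free_fo \<psi>"
| "poc_free_fo (PAll x \<phi>) = poc_free_fo \<phi> - {x}"
| "poc_free_fo (PEx x \<phi>) = poc_free_fo \<phi> - {x}"
| "poc_free_fo (PPoc ts \<phi>) = poc_free_fo \<phi> - set (concat (map fst ts))"

primrec poc_free_bool :: "'r poc \<Rightarrow> bvar set" where
  "poc_free_bool (PBool \<alpha>) = {\<alpha>}"
| "poc_free_bool (PNBool \<alpha>) = {\<alpha>}"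
| "poc_free_bool (PEq x y) = {}"
| "poc_free_bool (PNeq x y) = {}"
| "poc_free_bool (PRel R xs) = {}"
| "poc_free_bool (PNRel R xs) = {}"
| "poc_free_bool (POr \<phi> \<psi>) = poc_free_bool \<phi> \<union> poc_free_bool \<psi>"
| "poc_free_bool (PAnd \<phi> \<psi>) = poc_free_bool \<phi> \<union> poc_free_bool \<psi>"
| "poc_free_bool (PAll x \<phi>) = poc_free_bool \<phi>"
| "poc_free_bool (PEx x \<phi>) = poc_free_bool \<phi>"
| "poc_free_bool (PPoc ts \<phi>) = poc_free_bool \<phi> - set (map snd ts)"

text \<open>The assignment \<open>s(a\<^sub>1/xs\<^sub>1, \<dots>, a\<^sub>m/xs\<^sub>m, f\<^sub>1(a\<^sub>1)/\<alpha>\<^sub>1, \<dots>, f\<^sub>m(a\<^sub>m)/\<alpha>\<^sub>m)\<close>. Repeated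
  first-order variables receive equal values when the tuples are of the right pattern, so the
  order of the updates is immaterial.\<close>

definition upd_poc ::
    "'a assignment \<Rightarrow> (fovar list \<times> bvar) list \<Rightarrow> 'a list list \<Rightarrow> (nat \<Rightarrow> 'a list \<Rightarrow> bool)
      \<Rightarrow> 'a assignment" where
  "upd_poc s ts ass f =
     ((fst s)(concat (map fst ts) [\<mapsto>] concat ass),
      (snd s)(map snd ts [\<mapsto>] map (\<lambda>i. f i (ass ! i)) [0..<length ts]))"

primrec poc_sat :: "('r, 'a) struct \<Rightarrow> 'r poc \<Rightarrow> 'a assignment \<Rightarrow> bool" where
  "poc_sat M (PBool \<alpha>) s \<longleftrightarrow> bool_val s \<alpha> = True"
| "poc_sat M (PNBool \<alpha>) s \<longleftrightarrow> bool_val s \<alpha> = False"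
| "poc_sat M (PEq x y) s \<longleftrightarrow> fo_val s x = fo_val s y"
| "poc_sat M (PNeq x y) s \<longleftrightarrow> fo_val s x \<noteq> fo_val s y"
| "poc_sat M (PRel R xs) s \<longleftrightarrow> map (fo_val s) xs \<in> interp M R"
| "poc_sat M (PNRel R xs) s \<longleftrightarrow> map (fo_val s) xs \<notin> interp M R"
| "poc_sat M (POr \<phi> \<psi>) s \<longleftrightarrow> poc_sat M \<phi> s \<or> poc_sat M \<psi> s"
| "poc_sat M (PAnd \<phi> \<psi>) s \<longleftrightarrow> poc_sat M \<phi> s \<and> poc_sat M \<psi> s"
| "poc_sat M (PAll x \<phi>) s \<longleftrightarrow> (\<forall>a\<in>univ M. poc_sat M \<phi> (upd_fo s x a))"
| "poc_sat M (PEx x \<phi>) s \<longleftrightarrow> (\<exists>a\<in>univ M. poc_sat M \<phi> (upd_fo s x a))"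
| "poc_sat M (PPoc ts \<phi>) s \<longleftrightarrow>
     (\<exists>f :: nat \<Rightarrow> 'a list \<Rightarrow> bool. \<forall>ass.
        of_pattern (univ M) (pattern (map fst ts)) ass \<longrightarrow> poc_sat M \<phi> (upd_poc s ts ass f))"

definition poc_sentence :: "'r vocabulary \<Rightarrow> 'r poc \<Rightarrow> bool" where
  "poc_sentence \<tau> \<phi> \<longleftrightarrow> poc_formula \<tau> \<phi> \<and> poc_free_fo \<phi> = {} \<and> poc_free_bool \<phi> = {}"

definition poc_true :: "('r, 'a) struct \<Rightarrow> 'r poc \<Rightarrow> bool" where
  "poc_true M \<phi> \<longleftrightarrow> poc_sat M \<phi> empty_assignment"

end

theory Submission
  imports Defs "HOL-Library.FuncSet"
begin

text \<open>A dependence atom \<open>=(xs, \<alpha>)\<close> holds in a team iff the values of \<open>\<alpha>\<close> are given by a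
  function of the values of \<open>xs\<close>. Choosing such a function \<open>f\<close> for every occurrence of an atom
  turns team semantics into Tarskian semantics: a team satisfies \<open>\<phi>\<close> iff for some choice of
  functions all of its members satisfy \<open>\<phi>\<close> with each atom read as \<open>\<alpha> = f(xs)\<close>.

  A connective is simulated by universal quantifiers, existential Boolean quantifiers and
  dependence atoms whose arguments also list all variables already in scope. The additional
  arguments let the functions depend on the assignment at which the connective is evaluated, and
  renaming bound variables apart makes that assignment recoverable.

  Conversely, the part of a formula above its existential first-order quantifiers is brought into
  prenex form: the functions of its atoms, together with Skolem functions for \<open>\<exists>\<alpha>\<close>, are
  quantified by a single connective in front of all universal quantifiers. At \<open>\<exists>x\<psi>\<close>,
  boundedness says that the functions of \<open>\<psi>\<close> take the whole current assignment as an argument,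
  so they can be chosen separately at every assignment, after \<open>x\<close>.\<close>

section \<open>Total assignments\<close>

text \<open>One invariant, \<open>separates\<close>, carries the correctness proofs of both
  translations: in every team met there, the first-order names in scope determine the assignment,
  its Boolean part included. An arbitrary choice per member of the team is then a function of the
  names in scope. This is where the Skolem functions for \<open>DExB\<close> come from, why
  functions chosen at single assignments can be glued into one, and why the translation of a
  connective holds in a team iff it holds at each member. A name quantified again would destroy the
  invariant, so both translations draw their names from fresh intervals of numbers. The obstacle to
  a prenex form is disjunction. As the two disjuncts own disjoint intervals of names, valuations and
  families of functions can be spliced from two halves, so that a universal quantifier over both
  halves distributes over the disjunction. An existential first-order quantifier cannot be moved out
  likewise: its witness would become an element-valued function, while connectives supply only
  Boolean ones. Hence it opens a connective of its own.\<close>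

text \<open>The function attached to an atom is indexed by the path that leads to its occurrence through
  the binary connectives.\<close>

primrec fsat :: "('r, 'a) struct \<Rightarrow> 'r bd \<Rightarrow> (bool list \<Rightarrow> (fovar \<Rightarrow> 'a) \<Rightarrow> bool)
    \<Rightarrow> (fovar \<Rightarrow> 'a) \<Rightarrow> (bvar \<Rightarrow> bool) \<Rightarrow> bool" where
  "fsat M (DEq x y) f v b \<longleftrightarrow> v x = v y"
| "fsat M (DNeq x y) f v b \<longleftrightarrow> v x \<noteq> v y"
| "fsat M (DBool \<alpha>) f v b \<longleftrightarrow> b \<alpha>"
| "fsat M (DNBool \<alpha>) f v b \<longleftrightarrow> \<not> b \<alpha>"
| "fsat M (DDep xs \<alpha>) f v b \<longleftrightarrow> b \<alpha> = f [] (restrict v (set xs))"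
| "fsat M (DRel R xs) f v b \<longleftrightarrow> map v xs \<in> interp M R"
| "fsat M (DNRel R xs) f v b \<longleftrightarrow> map v xs \<notin> interp M R"
| "fsat M (DOr \<phi> \<psi>) f v b \<longleftrightarrow>
     fsat M \<phi> (\<lambda>p. f (True # p)) v b \<or> fsat M \<psi> (\<lambda>p. f (False # p)) v b"
| "fsat M (DAnd \<phi> \<psi>) f v b \<longleftrightarrow>
     fsat M \<phi> (\<lambda>p. f (True # p)) v b \<and> fsat M \<psi> (\<lambda>p. f (False # p)) v b"
| "fsat M (DAll x \<phi>) f v b \<longleftrightarrow> (\<forall>a\<in>univ M. fsat M \<phi> f (v(x := a)) b)"
| "fsat M (DEx x \<phi>) f v b \<longleftrightarrow> (\<exists>a\<in>univ M. fsat M \<phi> f (v(x := a)) b)"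
| "fsat M (DExB \<alpha> \<phi>) f v b \<longleftrightarrow> (\<exists>c. fsat M \<phi> f v (b(\<alpha> := c)))"

lemma fo_val_upd_fo [simp]: "fo_val (upd_fo s x a) = (fo_val s)(x := a)"
  by (auto simp: fun_eq_iff fo_val_def upd_fo_def)

lemma bool_val_upd_fo [simp]: "bool_val (upd_fo s x a) = bool_val s"
  by (auto simp: bool_val_def upd_fo_def)

lemma fo_val_upd_bool [simp]: "fo_val (upd_bool s \<alpha> c) = fo_val s"
  by (auto simp: fo_val_def upd_bool_def)

lemma bool_val_upd_bool [simp]: "bool_val (upd_bool s \<alpha> c) = (bool_val s)(\<alpha> := c)"
  by (auto simp: fun_eq_iff bool_val_def upd_bool_def)

section \<open>Team semantics as a choice of functions\<close>

text \<open>A function on nonempty paths is a pair of functions, told apart by the first bit. Both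
  sides of a binary connective thus get independent choices although \<open>fsat\<close> carries a
  single \<open>f\<close>.\<close>

lemma ex_merge_paths:
  "(\<exists>f. P (\<lambda>p. f (True # p)) (\<lambda>p. f (False # p))) \<longleftrightarrow> (\<exists>f g. P f g)"
proof
  assume "\<exists>f g. P f g"
  then obtain f g where "P f g" by (elim exE)
  then show "\<exists>f. P (\<lambda>p. f (True # p)) (\<lambda>p. f (False # p))"
    by (intro exI[of _ "\<lambda>q. if hd q then f (tl q) else g (tl q)"]) simp
next
  assume "\<exists>f. P (\<lambda>p. f (True # p)) (\<lambda>p. f (False # p))"
  then show "\<exists>f g. P f g" by (elim exE) (intro exI)
qed

text \<open>From functions to a split, the truth sets of the two sides serve as \<open>Y\<close> and
  \<open>Z\<close>; they may overlap, as the team disjunction permits.\<close>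

lemma ex_split_disj:
  "(\<exists>f g. \<forall>p\<in>X. A f p \<or> B g p) \<longleftrightarrow>
   (\<exists>Y Z. X = Y \<union> Z \<and> (\<exists>f. \<forall>p\<in>Y. A f p) \<and> (\<exists>g. \<forall>p\<in>Z. B g p))"
proof (intro iffI; elim exE conjE)
  fix f g assume *: "\<forall>p\<in>X. A f p \<or> B g p"
  have "X = {p\<in>X. A f p} \<union> {p\<in>X. B g p}" using * by blast
  moreover have "\<forall>p\<in>{p\<in>X. A f p}. A f p" "\<forall>p\<in>{p\<in>X. B g p}. B g p" by simp_all
  ultimately show "\<exists>Y Z. X = Y \<union> Z \<and> (\<exists>f. \<forall>p\<in>Y. A f p) \<and> (\<exists>g. \<forall>p\<in>Z. B g p)"
    by (intro exI conjI)
next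
  fix Y Z f g assume "X = Y \<union> Z" "\<forall>p\<in>Y. A f p" "\<forall>p\<in>Z. B g p"
  then show "\<exists>f g. \<forall>p\<in>X. A f p \<or> B g p" by (intro exI[of _ f] exI[of _ g]) blast
qed

lemma ex_fun_at: "(\<exists>F. P (F a)) \<longleftrightarrow> (\<exists>h. P h)"
proof
  assume "\<exists>h. P h"
  then obtain h where "P h" ..
  then show "\<exists>F. P (F a)" by (intro exI[of _ "\<lambda>_. h"])
next
  assume "\<exists>F. P (F a)"
  then obtain F where "P (F a)" ..
  then show "\<exists>h. P h" by (rule exI[of _ "F a"])
qed

text \<open>Removes a universal quantifier over valuations into the universe when its body does not
  mention the valuation.\<close>

lemma ex_range_subset: "A \<noteq> {} \<Longrightarrow> \<exists>g. range g \<subseteq> A"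
proof -
  assume "A \<noteq> {}"
  then obtain a where "a \<in> A" by blast
  then show "\<exists>g. range g \<subseteq> A" by (intro exI[of _ "\<lambda>_. a"]) auto
qed

lemma restrict_eq_iff: "restrict u S = restrict w S \<longleftrightarrow> (\<forall>x\<in>S. u x = w x)"
  by (auto simp: restrict_def fun_eq_iff)

text \<open>\<open>h\<close> reads \<open>b\<close> off an arbitrary member of \<open>X\<close> with
  the given restriction; by the dependence it does not matter which. \<open>X\<close> is a set of
  indices with accessors \<open>v\<close> and \<open>b\<close>, so that teams, sets of total
  assignments and Skolem functions are all covered.\<close>

lemma dependence_function:
  "(\<forall>p\<in>X. \<forall>q\<in>X. (\<forall>x\<in>S. v p x = v q x) \<longrightarrow> b p = b q) \<longleftrightarrow>
   (\<exists>h. \<forall>p\<in>X. b p = h (restrict (v p) S))"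
proof
  assume *: "\<forall>p\<in>X. \<forall>q\<in>X. (\<forall>x\<in>S. v p x = v q x) \<longrightarrow> b p = b q"
  define r where "r u = (SOME q. q \<in> X \<and> restrict (v q) S = u)" for u
  have "b p = b (r (restrict (v p) S))" if "p \<in> X" for p
  proof -
    have "r (restrict (v p) S) \<in> X \<and> restrict (v (r (restrict (v p) S))) S = restrict (v p) S"
      unfolding r_def by (rule someI[of _ p]) (use that in simp)
    then show ?thesis
      using *[rule_format, OF that, of "r (restrict (v p) S)"] by (simp add: restrict_eq_iff)
  qed
  then show "\<exists>h. \<forall>p\<in>X. b p = h (restrict (v p) S)"
    by (intro exI[of _ "\<lambda>u. b (r u)"]) blast
next
  assume "\<exists>h. \<forall>p\<in>X. b p = h (restrict (v p) S)"
  then obtain h where h: "\<forall>p\<in>X. b p = h (restrict (v p) S)" ..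
  show "\<forall>p\<in>X. \<forall>q\<in>X. (\<forall>x\<in>S. v p x = v q x) \<longrightarrow> b p = b q"
    unfolding restrict_eq_iff[symmetric] using h by simp
qed

text \<open>Only \<open>f\<close> is global to the team; everything else becomes pointwise. A
  witness for \<open>DEx\<close> or \<open>DExB\<close> may depend on the whole assignment, so by
  choice a witness function exists iff every member has a witness. Assignments are read only through
  \<open>fo_val\<close> and \<open>bool_val\<close>, hence total valuations suffice.\<close>

lemma bd_sat_iff_fsat:
  "bd_sat M \<phi> X \<longleftrightarrow> (\<exists>f. \<forall>s\<in>X. fsat M \<phi> f (fo_val s) (bool_val s))"
proof (induction \<phi> arbitrary: X)
  case (DDep xs \<alpha>)
  have "bd_sat M (DDep xs \<alpha>) X \<longleftrightarrow>
      (\<exists>h. \<forall>s\<in>X. bool_val s \<alpha> = h (restrict (fo_val s) (set xs)))"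
    unfolding bd_sat.simps by (rule dependence_function)
  also have "\<dots> \<longleftrightarrow> (\<exists>f. \<forall>s\<in>X. fsat M (DDep xs \<alpha>) f (fo_val s) (bool_val s))"
    unfolding fsat.simps by (rule ex_fun_at[symmetric])
  finally show ?case .
next
  case (DOr \<phi> \<psi>)
  then show ?case unfolding bd_sat.simps fsat.simps ex_merge_paths[of "\<lambda>f g. \<forall>s\<in>X.
    fsat M \<phi> f (fo_val s) (bool_val s) \<or> fsat M \<psi> g (fo_val s) (bool_val s)"] ex_split_disj by simp
next
  case (DAnd \<phi> \<psi>)
  have "bd_sat M (DAnd \<phi> \<psi>) X \<longleftrightarrow>
      (\<exists>f g. \<forall>s\<in>X. fsat M \<phi> f (fo_val s) (bool_val s) \<and> fsat M \<psi> g (fo_val s) (bool_val s))"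
    by (simp add: DAnd.IH ball_conj_distrib)
  then show ?case unfolding fsat.simps ex_merge_paths[of "\<lambda>f g. \<forall>s\<in>X.
    fsat M \<phi> f (fo_val s) (bool_val s) \<and> fsat M \<psi> g (fo_val s) (bool_val s)"] .
next
  case (DAll x \<phi>)
  have "(\<forall>s\<in>{upd_fo s x a |s a. s \<in> X \<and> a \<in> univ M}. fsat M \<phi> f (fo_val s) (bool_val s)) \<longleftrightarrow>
      (\<forall>s\<in>X. fsat M (DAll x \<phi>) f (fo_val s) (bool_val s))" for f
  proof -
    have "{upd_fo s x a |s a. s \<in> X \<and> a \<in> univ M} = (\<lambda>(s, a). upd_fo s x a) ` (X \<times> univ M)" by auto
    then show ?thesis by simp
  qed
  then show ?case by (simp add: DAll.IH)
next
  case (DEx x \<phi>)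
  have *: "(\<forall>s\<in>{upd_fo s x (F s) |s. s \<in> X}. fsat M \<phi> f (fo_val s) (bool_val s)) \<longleftrightarrow>
      (\<forall>s\<in>X. fsat M \<phi> f ((fo_val s)(x := F s)) (bool_val s))" for f F
    unfolding Setcompr_eq_image by simp
  have "bd_sat M (DEx x \<phi>) X \<longleftrightarrow>
      (\<exists>f F. \<forall>s\<in>X. F s \<in> univ M \<and> fsat M \<phi> f ((fo_val s)(x := F s)) (bool_val s))"
    by (simp only: bd_sat.simps DEx.IH * ball_conj_distrib)
      (rule iffI; elim exE conjE; intro exI conjI; assumption)
  also have "\<dots> \<longleftrightarrow> (\<exists>f. \<forall>s\<in>X. fsat M (DEx x \<phi>) f (fo_val s) (bool_val s))"
    unfolding fsat.simps bchoice_iff Bex_def by simp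
  finally show ?case .
next
  case (DExB \<alpha> \<phi>)
  have *: "(\<forall>s\<in>{upd_bool s \<alpha> (F s) |s. s \<in> X}. fsat M \<phi> f (fo_val s) (bool_val s)) \<longleftrightarrow>
      (\<forall>s\<in>X. fsat M \<phi> f (fo_val s) ((bool_val s)(\<alpha> := F s)))" for f F
    unfolding Setcompr_eq_image by simp
  have "bd_sat M (DExB \<alpha> \<phi>) X \<longleftrightarrow>
      (\<exists>f F. \<forall>s\<in>X. fsat M \<phi> f (fo_val s) ((bool_val s)(\<alpha> := F s)))"
    by (simp only: bd_sat.simps DExB.IH *) (rule ex_comm)
  also have "\<dots> \<longleftrightarrow> (\<exists>f. \<forall>s\<in>X. fsat M (DExB \<alpha> \<phi>) f (fo_val s) (bool_val s))"
    unfolding fsat.simps bchoice_iff by simp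
  finally show ?case .
qed simp_all

text \<open>Two conventions differ from those for \<open>poc_sat\<close>: functions are indexed by the Boolean
  variables instead of by positions, and they take the restricted assignment as argument.\<close>

definition tup :: "(fovar list \<times> bvar) list \<Rightarrow> bvar \<Rightarrow> fovar set" where
  "tup E \<beta> = {x. \<exists>xs. (xs, \<beta>) \<in> set E \<and> x \<in> set xs}"

definition bext :: "(fovar list \<times> bvar) list \<Rightarrow> (bvar \<Rightarrow> (fovar \<Rightarrow> 'a) \<Rightarrow> bool)
    \<Rightarrow> (fovar \<Rightarrow> 'a) \<Rightarrow> (bvar \<Rightarrow> bool) \<Rightarrow> bvar \<Rightarrow> bool" where
  "bext E F v b = (\<lambda>\<beta>. if \<beta> \<in> snd ` set E then F \<beta> (restrict v (tup E \<beta>)) else b \<beta>)"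

primrec psat :: "('r, 'a) struct \<Rightarrow> 'r poc \<Rightarrow> (fovar \<Rightarrow> 'a) \<Rightarrow> (bvar \<Rightarrow> bool) \<Rightarrow> bool" where
  "psat M (PBool \<alpha>) v b \<longleftrightarrow> b \<alpha>"
| "psat M (PNBool \<alpha>) v b \<longleftrightarrow> \<not> b \<alpha>"
| "psat M (PEq x y) v b \<longleftrightarrow> v x = v y"
| "psat M (PNeq x y) v b \<longleftrightarrow> v x \<noteq> v y"
| "psat M (PRel R xs) v b \<longleftrightarrow> map v xs \<in> interp M R"
| "psat M (PNRel R xs) v b \<longleftrightarrow> map v xs \<notin> interp M R"
| "psat M (POr \<phi> \<psi>) v b \<longleftrightarrow> psat M \<phi> v b \<or> psat M \<psi> v b"
| "psat M (PAnd \<phi> \<psi>) v b \<longleftrightarrow> psat M \<phi> v b \<and> psat M \<psi> v b"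
| "psat M (PAll x \<phi>) v b \<longleftrightarrow> (\<forall>a\<in>univ M. psat M \<phi> (v(x := a)) b)"
| "psat M (PEx x \<phi>) v b \<longleftrightarrow> (\<exists>a\<in>univ M. psat M \<phi> (v(x := a)) b)"
| "psat M (PPoc ts \<phi>) v b \<longleftrightarrow>
     (\<exists>F. \<forall>g. range g \<subseteq> univ M \<longrightarrow>
        psat M \<phi> (override_on v g (set (concat (map fst ts))))
          (bext ts F (override_on v g (set (concat (map fst ts)))) b))"

section \<open>Connectives over total valuations\<close>

lemma map_upds_map: "(m(xs [\<mapsto>] map g xs)) x = (if x \<in> set xs then Some (g x) else m x)"
  by (induction xs arbitrary: m) auto

text \<open>Equal variables force equal entries, so tuples of the right pattern amount to a
  well-defined valuation of the variables; nonemptiness of \<open>A\<close> supplies a value for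
  variables outside all tuples. Quantifying over tuples thus becomes quantifying over valuations
  \<open>g\<close>.\<close>

lemma of_pattern_iff:
  assumes "A \<noteq> {}"
  shows "of_pattern A (pattern xss) ass \<longleftrightarrow> (\<exists>g. range g \<subseteq> A \<and> ass = map (map g) xss)"
proof
  assume *: "of_pattern A (pattern xss) ass"
  then have len: "map length ass = map length xss" and sub: "\<And>as. as \<in> set ass \<Longrightarrow> set as \<subseteq> A"
    by (auto simp: of_pattern_def pattern_def)
  have eq: "ass ! i ! j = ass ! k ! l"
    if "i < length xss" "j < length (xss ! i)" "k < length xss" "l < length (xss ! k)"
      "xss ! i ! j = xss ! k ! l" for i j k l
  proof -
    have 1: "\<forall>(i, j, k, l)\<in>snd (pattern xss). ass ! i ! j = ass ! k ! l"
      using * unfolding of_pattern_def by (elim conjE)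
    have 2: "(i, j, k, l) \<in> snd (pattern xss)" using that by (simp add: pattern_def)
    from bspec[OF 1 2] show ?thesis by (simp only: prod.case)
  qed
  have len1: "length ass = length xss" using len map_eq_imp_length_eq by blast
  have len2: "length (ass ! i) = length (xss ! i)" if "i < length xss" for i
    using len that len1 by (metis nth_map)
  have entry: "ass ! i ! j \<in> A" if "i < length xss" "j < length (xss ! i)" for i j
    using sub[of "ass ! i"] that len1 len2[of i] by auto
  obtain a where a: "a \<in> A" using assms by blast
  have "\<exists>c. c \<in> A \<and> (\<forall>i j. i < length xss \<longrightarrow> j < length (xss ! i) \<longrightarrow> xss ! i ! j = x \<longrightarrow> ass ! i ! j = c)"
    for x
  proof (cases "\<exists>k l. k < length xss \<and> l < length (xss ! k) \<and> xss ! k ! l = x")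
    case True
    then obtain k l where kl: "k < length xss" "l < length (xss ! k)" "xss ! k ! l = x" by (elim exE conjE)
    show ?thesis
    proof (intro exI[of _ "ass ! k ! l"] conjI allI impI)
      fix i j assume "i < length xss" "j < length (xss ! i)" "xss ! i ! j = x"
      then show "ass ! i ! j = ass ! k ! l" using kl eq[of i j k l] by simp
    qed (rule entry[OF kl(1,2)])
  next
    case False
    then show ?thesis using a by (intro exI[of _ a]) auto
  qed
  then obtain g where g: "\<And>x. g x \<in> A"
    "\<And>x i j. \<lbrakk>i < length xss; j < length (xss ! i); xss ! i ! j = x\<rbrakk> \<Longrightarrow> ass ! i ! j = g x"
    by metis
  have "ass = map (map g) xss"
    using len1 len2 g(2) by (intro nth_equalityI) (auto intro!: nth_equalityI)
  with g(1) show "\<exists>g. range g \<subseteq> A \<and> ass = map (map g) xss" by (intro exI[of _ g]) blast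
next
  assume "\<exists>g. range g \<subseteq> A \<and> ass = map (map g) xss"
  then obtain g where g: "range g \<subseteq> A" and ass: "ass = map (map g) xss" by (elim exE conjE)
  have "map length ass = map length xss" unfolding ass by simp
  moreover have "\<forall>as\<in>set ass. set as \<subseteq> A" unfolding ass using g by auto
  ultimately show "of_pattern A (pattern xss) ass"
    by (auto simp: of_pattern_def pattern_def ass)
qed

lemma tup_nth:
  assumes "distinct (map snd E)" "i < length E"
  shows "tup E (snd (E ! i)) = set (fst (E ! i))"
proof -
  \<comment> \<open>The Boolean variable is the key here, but \<open>eq_key_imp_eq_value\<close>
    takes first components as keys; hence the swap.\<close>
  have "(xs, snd (E ! i)) \<in> set E \<longleftrightarrow> xs = fst (E ! i)" for xs
    using assms eq_key_imp_eq_value[of "map prod.swap E" "snd (E ! i)" xs "fst (E ! i)"]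
    by (force simp: comp_def)
  then show ?thesis by (simp add: tup_def)
qed

lemma fo_val_upd_poc:
  "fo_val (upd_poc s ts (map (map g) (map fst ts)) f) =
     override_on (fo_val s) g (set (concat (map fst ts)))"
proof -
  have "concat (map (map g) (map fst ts)) = map g (concat (map fst ts))"
    by (simp add: map_concat)
  then show ?thesis
    by (auto simp: fo_val_def upd_poc_def fun_eq_iff override_on_def map_upds_map simp del: map_map)
qed

text \<open>The premise on \<open>f\<close> and \<open>F\<close> is the dictionary between functions
  indexed by position, taking lists, and functions indexed by variable, taking restricted
  assignments. It is met in both directions of the equivalence of \<open>poc_sat\<close> and
  \<open>psat\<close>.\<close>

lemma bool_val_upd_poc:
  assumes d: "distinct (map snd ts)"
    and F: "\<And>i. i < length ts \<Longrightarrow>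
      f i (map g (fst (ts ! i))) = F (snd (ts ! i)) (restrict u (set (fst (ts ! i))))"
  shows "bool_val (upd_poc s ts (map (map g) (map fst ts)) f) = bext ts F u (bool_val s)"
proof -
  have "map (\<lambda>i. f i (map (map g) (map fst ts) ! i)) [0..<length ts] =
      map (\<lambda>\<beta>. F \<beta> (restrict u (tup ts \<beta>))) (map snd ts)"
    by (rule nth_equalityI) (simp_all add: F tup_nth[OF d])
  then show ?thesis
    by (auto simp: fun_eq_iff bool_val_def upd_poc_def bext_def map_upds_map simp del: map_map)
qed

lemma poc_sat_iff_psat:
  assumes ne: "univ M \<noteq> {}" and "poc_formula \<tau> \<phi>"
  shows "poc_sat M \<phi> s \<longleftrightarrow> psat M \<phi> (fo_val s) (bool_val s)"
  using assms(2)
proof (induction \<phi> arbitrary: s)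
  case (PPoc ts \<phi>)
  let ?V = "set (concat (map fst ts))"
  have d: "distinct (map snd ts)" and IH: "\<And>s. poc_sat M \<phi> s \<longleftrightarrow> psat M \<phi> (fo_val s) (bool_val s)"
    using PPoc by auto
  have sub: "set (fst (ts ! i)) \<subseteq> ?V" if "i < length ts" for i
    using nth_mem[OF that] by auto
  have 1: "poc_sat M (PPoc ts \<phi>) s \<longleftrightarrow> (\<exists>f. \<forall>g. range g \<subseteq> univ M \<longrightarrow>
      psat M \<phi> (override_on (fo_val s) g ?V) (bool_val (upd_poc s ts (map (map g) (map fst ts)) f)))"
  proof -
    have "(\<forall>ass. (\<exists>g. range g \<subseteq> univ M \<and> ass = h g) \<longrightarrow> P ass) \<longleftrightarrow>
        (\<forall>g. range g \<subseteq> univ M \<longrightarrow> P (h g))" for h :: "(nat \<Rightarrow> 'a) \<Rightarrow> 'a list list" and P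
      by blast
    then show ?thesis
      by (simp only: poc_sat.simps of_pattern_iff[OF ne] IH fo_val_upd_poc)
  qed
  show ?case unfolding 1 psat.simps
  proof (intro iffI; elim exE)
    fix f assume *: "\<forall>g. range g \<subseteq> univ M \<longrightarrow>
      psat M \<phi> (override_on (fo_val s) g ?V) (bool_val (upd_poc s ts (map (map g) (map fst ts)) f))"
    \<comment> \<open>By distinctness of the Boolean variables the position of
      \<open>\<beta>\<close> is unique.\<close>
    define F where "F \<beta> u = (let i = (THE i. i < length ts \<and> snd (ts ! i) = \<beta>) in f i (map u (fst (ts ! i))))" for \<beta> u
    have F: "F (snd (ts ! i)) u = f i (map u (fst (ts ! i)))" if "i < length ts" for i u
    proof -
      have "(THE j. j < length ts \<and> snd (ts ! j) = snd (ts ! i)) = i"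
        using d that by (auto simp: distinct_conv_nth)
      then show ?thesis by (simp add: F_def)
    qed
    have "bool_val (upd_poc s ts (map (map g) (map fst ts)) f) =
       bext ts F (override_on (fo_val s) g ?V) (bool_val s)" for g
    proof (rule bool_val_upd_poc[OF d])
      fix i assume i: "i < length ts"
      have "map g (fst (ts ! i)) = map (restrict (override_on (fo_val s) g ?V) (set (fst (ts ! i)))) (fst (ts ! i))"
        using sub[OF i] by (auto simp: override_on_def)
      then show "f i (map g (fst (ts ! i))) =
         F (snd (ts ! i)) (restrict (override_on (fo_val s) g ?V) (set (fst (ts ! i))))"
        by (simp only: F[OF i])
    qed
    with * show "\<exists>F. \<forall>g. range g \<subseteq> univ M \<longrightarrow> psat M \<phi> (override_on (fo_val s) g ?V)
       (bext ts F (override_on (fo_val s) g ?V) (bool_val s))" by auto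
  next
    fix F assume *: "\<forall>g. range g \<subseteq> univ M \<longrightarrow> psat M \<phi> (override_on (fo_val s) g ?V)
       (bext ts F (override_on (fo_val s) g ?V) (bool_val s))"
    \<comment> \<open>The list of values is paired with the tuple to get an assignment back. If a
      list gives one variable two values, \<open>map_of\<close> takes the first, but only lists
      obtained by mapping some \<open>g\<close> over the tuple matter.\<close>
    define f where "f i as = F (snd (ts ! i)) (restrict (\<lambda>x. the (map_of (zip (fst (ts ! i)) as) x)) (set (fst (ts ! i))))" for i as
    have "bool_val (upd_poc s ts (map (map g) (map fst ts)) f) =
       bext ts F (override_on (fo_val s) g ?V) (bool_val s)" for g
    proof (rule bool_val_upd_poc[OF d])
      fix i assume i: "i < length ts"
      have "restrict (\<lambda>x. the (map_of (zip (fst (ts ! i)) (map g (fst (ts ! i)))) x)) (set (fst (ts ! i))) =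
        restrict (override_on (fo_val s) g ?V) (set (fst (ts ! i)))"
        using sub[OF i] by (auto simp: override_on_def map_of_zip_map fun_eq_iff restrict_def)
      then show "f i (map g (fst (ts ! i))) =
         F (snd (ts ! i)) (restrict (override_on (fo_val s) g ?V) (set (fst (ts ! i))))"
        by (simp add: f_def)
    qed
    with * show "\<exists>f. \<forall>g. range g \<subseteq> univ M \<longrightarrow> psat M \<phi> (override_on (fo_val s) g ?V)
       (bool_val (upd_poc s ts (map (map g) (map fst ts)) f))" by metis
  qed
qed auto

lemma psat_cong:
  "\<lbrakk>\<And>x. x \<in> poc_free_fo \<phi> \<Longrightarrow> v x = v' x; \<And>\<beta>. \<beta> \<in> poc_free_bool \<phi> \<Longrightarrow> b \<beta> = b' \<beta>\<rbrakk>
    \<Longrightarrow> psat M \<phi> v b \<longleftrightarrow> psat M \<phi> v' b'"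
proof (induction \<phi> arbitrary: v v' b b')
  case (PRel R xs)
  then have "map v xs = map v' xs" by simp
  then show ?case by (simp del: map_eq_conv)
next
  case (PNRel R xs)
  then have "map v xs = map v' xs" by simp
  then show ?case by (simp del: map_eq_conv)
next
  case (POr \<phi> \<psi>)
  have "psat M \<phi> v b = psat M \<phi> v' b'" by (rule POr.IH) (use POr.prems in auto)
  moreover have "psat M \<psi> v b = psat M \<psi> v' b'" by (rule POr.IH) (use POr.prems in auto)
  ultimately show ?case by simp
next
  case (PAnd \<phi> \<psi>)
  have "psat M \<phi> v b = psat M \<phi> v' b'" by (rule PAnd.IH) (use PAnd.prems in auto)
  moreover have "psat M \<psi> v b = psat M \<psi> v' b'" by (rule PAnd.IH) (use PAnd.prems in auto)
  ultimately show ?case by simp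
next
  case (PAll x \<phi>)
  have "psat M \<phi> (v(x := a)) b = psat M \<phi> (v'(x := a)) b'" for a
    by (rule PAll.IH) (use PAll.prems in auto)
  then show ?case by simp
next
  case (PEx x \<phi>)
  have "psat M \<phi> (v(x := a)) b = psat M \<phi> (v'(x := a)) b'" for a
    by (rule PEx.IH) (use PEx.prems in auto)
  then show ?case by simp
next
  case (PPoc ts \<phi>)
  let ?V = "set (concat (map fst ts))"
  have "restrict (override_on v g ?V) (tup ts \<beta>) = restrict (override_on v' g ?V) (tup ts \<beta>)" for g \<beta>
    by (rule restrict_ext) (auto simp: override_on_def tup_def)
  then have "psat M \<phi> (override_on v g ?V) (bext ts F (override_on v g ?V) b) =
      psat M \<phi> (override_on v' g ?V) (bext ts F (override_on v' g ?V) b')" for F g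
    by (intro PPoc.IH) (use PPoc.prems in \<open>auto simp: override_on_def bext_def\<close>)
  then show ?case by simp
qed auto

section \<open>From partially-ordered connectives to dependence atoms\<close>

text \<open>The team reading of \<open>fsat\<close>, in view of \<open>bd_sat_iff_fsat\<close>. The
  team clauses are recovered for it because the simulation of connectives argues about splits of
  teams and about pairs of members that agree on some names.\<close>

definition tsat :: "('r, 'a) struct \<Rightarrow> 'r bd \<Rightarrow> ((fovar \<Rightarrow> 'a) \<times> (bvar \<Rightarrow> bool)) set \<Rightarrow> bool" where
  "tsat M \<phi> X \<longleftrightarrow> (\<exists>f. \<forall>p\<in>X. fsat M \<phi> f (fst p) (snd p))"

lemma tsat_DDep:
  "tsat M (DDep xs \<alpha>) X \<longleftrightarrow>
     (\<forall>p\<in>X. \<forall>q\<in>X. (\<forall>x\<in>set xs. fst p x = fst q x) \<longrightarrow> snd p \<alpha> = snd q \<alpha>)"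
  unfolding dependence_function tsat_def fsat.simps by (rule ex_fun_at)

lemma tsat_DOr: "tsat M (DOr \<phi> \<psi>) X \<longleftrightarrow> (\<exists>Y Z. X = Y \<union> Z \<and> tsat M \<phi> Y \<and> tsat M \<psi> Z)"
  unfolding tsat_def fsat.simps ex_merge_paths[of
      "\<lambda>f g. \<forall>p\<in>X. fsat M \<phi> f (fst p) (snd p) \<or> fsat M \<psi> g (fst p) (snd p)"]
  by (rule ex_split_disj)

lemma tsat_DAnd: "tsat M (DAnd \<phi> \<psi>) X \<longleftrightarrow> tsat M \<phi> X \<and> tsat M \<psi> X"
  unfolding tsat_def fsat.simps ex_merge_paths[of
      "\<lambda>f g. \<forall>p\<in>X. fsat M \<phi> f (fst p) (snd p) \<and> fsat M \<psi> g (fst p) (snd p)"]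
  by (simp add: ball_conj_distrib)

lemma tsat_foldr_DAnd:
  "tsat M (foldr DAnd ds \<psi>) X \<longleftrightarrow> (\<forall>\<delta>\<in>set ds. tsat M \<delta> X) \<and> tsat M \<psi> X"
  by (induction ds) (auto simp: tsat_DAnd)

lemma tsat_DAll:
  "tsat M (DAll x \<phi>) X \<longleftrightarrow> tsat M \<phi> ((\<lambda>(p, a). ((fst p)(x := a), snd p)) ` (X \<times> univ M))"
  by (simp add: tsat_def)

lemma tsat_DEx:
  "tsat M (DEx x \<phi>) X \<longleftrightarrow>
     (\<exists>H. (\<forall>p\<in>X. H p \<in> univ M) \<and> tsat M \<phi> ((\<lambda>p. ((fst p)(x := H p), snd p)) ` X))"
proof -
  have "tsat M (DEx x \<phi>) X \<longleftrightarrow>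
      (\<exists>f H. \<forall>p\<in>X. H p \<in> univ M \<and> fsat M \<phi> f ((fst p)(x := H p)) (snd p))"
    unfolding tsat_def fsat.simps Bex_def bchoice_iff ..
  then show ?thesis
    by (simp add: tsat_def ball_conj_distrib del: ball_simps split_paired_Ex) (subst ex_comm, simp)
qed

lemma fsat_foldr_DAll:
  assumes "univ M \<noteq> {}"
  shows "fsat M (foldr DAll xs \<psi>) f v b \<longleftrightarrow>
    (\<forall>g. range g \<subseteq> univ M \<longrightarrow> fsat M \<psi> f (override_on v g (set xs)) b)"
proof (induction xs arbitrary: v)
  case Nil
  then show ?case by (simp add: ex_range_subset[OF assms])
next
  case (Cons x xs)
  \<comment> \<open>If \<open>x\<close> is quantified again further in, its outer value is
    overwritten and \<open>g\<close> stays as it is; otherwise \<open>a\<close> is stored in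
    \<open>g\<close>.\<close>
  have *: "override_on (v(x := a)) g (set xs) =
      override_on v (if x \<in> set xs then g else g(x := a)) (set (x # xs))" for g a
    by (auto simp: override_on_def)
  have **: "override_on v g (set (x # xs)) = override_on (v(x := g x)) g (set xs)" for g
    by (auto simp: override_on_def)
  show ?case
  proof
    assume "fsat M (foldr DAll (x # xs) \<psi>) f v b"
    then show "\<forall>g. range g \<subseteq> univ M \<longrightarrow> fsat M \<psi> f (override_on v g (set (x # xs))) b"
      unfolding ** foldr.simps o_apply fsat.simps Cons.IH by blast
  next
    assume "\<forall>g. range g \<subseteq> univ M \<longrightarrow> fsat M \<psi> f (override_on v g (set (x # xs))) b"
    moreover have "range (if x \<in> set xs then g else g(x := a)) \<subseteq> univ M"
      if "range g \<subseteq> univ M" "a \<in> univ M" for g a using that by auto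
    ultimately show "fsat M (foldr DAll (x # xs) \<psi>) f v b"
      unfolding foldr.simps o_apply fsat.simps Cons.IH * by blast
  qed
qed

lemma fsat_foldr_DExB:
  "fsat M (foldr DExB bs \<psi>) f v b \<longleftrightarrow> (\<exists>h. fsat M \<psi> f v (override_on b h (set bs)))"
proof (induction bs arbitrary: b)
  case (Cons \<beta> bs)
  have *: "override_on (b(\<beta> := c)) h (set bs) =
      override_on b (if \<beta> \<in> set bs then h else h(\<beta> := c)) (set (\<beta> # bs))" for h c
    by (auto simp: override_on_def)
  have **: "override_on b h (set (\<beta> # bs)) = override_on (b(\<beta> := h \<beta>)) h (set bs)" for h
    by (auto simp: override_on_def)
  show ?case
  proof
    assume "fsat M (foldr DExB (\<beta> # bs) \<psi>) f v b"
    then obtain c h where "fsat M \<psi> f v (override_on (b(\<beta> := c)) h (set bs))"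
      unfolding foldr.simps o_apply fsat.simps Cons.IH by blast
    then show "\<exists>h. fsat M \<psi> f v (override_on b h (set (\<beta> # bs)))"
      unfolding * by (rule exI[of _ "if \<beta> \<in> set bs then h else h(\<beta> := c)"])
  next
    assume "\<exists>h. fsat M \<psi> f v (override_on b h (set (\<beta> # bs)))"
    then show "fsat M (foldr DExB (\<beta> # bs) \<psi>) f v b"
      unfolding ** foldr.simps o_apply fsat.simps Cons.IH by blast
  qed
qed simp

text \<open>Fresh variables are numbered upwards from \<open>n\<close>: a variable \<open>x\<close> bound by a connective
  becomes \<open>n + x\<close>. Number 0 is never bound; it serves as the image of variables not in scope.\<close>

definition shift :: "nat \<Rightarrow> fovar set \<Rightarrow> (fovar \<Rightarrow> fovar) \<Rightarrow> fovar \<Rightarrow> fovar" where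
  "shift n V \<rho> = (\<lambda>x. if x \<in> V then n + x else \<rho> x)"

definition poc_vars :: "(fovar list \<times> bvar) list \<Rightarrow> fovar list" where
  "poc_vars ts = concat (map fst ts)"

text \<open>\<open>n\<close> is the next free name, and the names in scope are
  \<open>1, ..., n - 1\<close>. To preserve this, a connective quantifies an entire interval of
  length \<open>k\<close>, including numbers that come from none of its variables; \<open>k\<close>
  exceeds each of its variables because a sum bounds its summands. An atom lists the old names, so
  that its function may vary with the assignment, and the renamed tuple of its own Boolean variable.
  Boolean variables keep their names.\<close>

primrec bd_of_poc :: "nat \<Rightarrow> (fovar \<Rightarrow> fovar) \<Rightarrow> 'r poc \<Rightarrow> 'r bd" where
  "bd_of_poc n \<rho> (PBool \<alpha>) = DBool \<alpha>"
| "bd_of_poc n \<rho> (PNBool \<alpha>) = DNBool \<alpha>"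
| "bd_of_poc n \<rho> (PEq x y) = DEq (\<rho> x) (\<rho> y)"
| "bd_of_poc n \<rho> (PNeq x y) = DNeq (\<rho> x) (\<rho> y)"
| "bd_of_poc n \<rho> (PRel R xs) = DRel R (map \<rho> xs)"
| "bd_of_poc n \<rho> (PNRel R xs) = DNRel R (map \<rho> xs)"
| "bd_of_poc n \<rho> (POr \<phi> \<psi>) = DOr (bd_of_poc n \<rho> \<phi>) (bd_of_poc n \<rho> \<psi>)"
| "bd_of_poc n \<rho> (PAnd \<phi> \<psi>) = DAnd (bd_of_poc n \<rho> \<phi>) (bd_of_poc n \<rho> \<psi>)"
| "bd_of_poc n \<rho> (PAll x \<phi>) = DAll n (bd_of_poc (Suc n) (\<rho>(x := n)) \<phi>)"
| "bd_of_poc n \<rho> (PEx x \<phi>) = DEx n (bd_of_poc (Suc n) (\<rho>(x := n)) \<phi>)"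
| "bd_of_poc n \<rho> (PPoc ts \<phi>) =
     (let \<rho>' = shift n (set (poc_vars ts)) \<rho>; k = Suc (sum_list (poc_vars ts)) in
      foldr DAll [n..<n + k] (foldr DExB (map snd ts)
        (foldr DAnd (map (\<lambda>(xs, \<alpha>). DDep ([1..<n] @ map \<rho>' xs) \<alpha>) ts)
          (bd_of_poc (n + k) \<rho>' \<phi>))))"

section \<open>The translated connectives lie in the bounded fragment\<close>

lemma poc_vars_less: "x \<in> set (poc_vars ts) \<Longrightarrow> x < Suc (sum_list (poc_vars ts))"
  using member_le_sum_list[of x "poc_vars ts"] by simp

lemma bd_formula_foldr_DAll [simp]:
  "bd_formula \<tau> (foldr DAll xs \<psi>) \<longleftrightarrow> bd_formula \<tau> \<psi>"
  by (induction xs) auto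

lemma bd_formula_foldr_DExB [simp]:
  "bd_formula \<tau> (foldr DExB bs \<psi>) \<longleftrightarrow> bd_formula \<tau> \<psi>"
  by (induction bs) auto

lemma bd_formula_foldr_DAnd [simp]:
  "bd_formula \<tau> (foldr DAnd \<delta>s \<psi>) \<longleftrightarrow> (\<forall>\<delta>\<in>set \<delta>s. bd_formula \<tau> \<delta>) \<and> bd_formula \<tau> \<psi>"
  by (induction \<delta>s) auto

lemma bd_free_fo_foldr_DAll [simp]:
  "bd_free_fo (foldr DAll xs \<psi>) = bd_free_fo \<psi> - set xs"
  by (induction xs) auto

lemma bd_free_fo_foldr_DExB [simp]:
  "bd_free_fo (foldr DExB bs \<psi>) = bd_free_fo \<psi>"
  by (induction bs) auto

lemma bd_free_fo_foldr_DAnd [simp]: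
  "bd_free_fo (foldr DAnd \<delta>s \<psi>) = (\<Union>\<delta>\<in>set \<delta>s. bd_free_fo \<delta>) \<union> bd_free_fo \<psi>"
  by (induction \<delta>s) auto

lemma bd_free_bool_foldr_DAll [simp]:
  "bd_free_bool (foldr DAll xs \<psi>) = bd_free_bool \<psi>"
  by (induction xs) auto

lemma bd_free_bool_foldr_DExB [simp]:
  "bd_free_bool (foldr DExB bs \<psi>) = bd_free_bool \<psi> - set bs"
  by (induction bs) auto

lemma bd_free_bool_foldr_DAnd [simp]:
  "bd_free_bool (foldr DAnd \<delta>s \<psi>) = (\<Union>\<delta>\<in>set \<delta>s. bd_free_bool \<delta>) \<union> bd_free_bool \<psi>"
  by (induction \<delta>s) auto

lemma dep_atoms_DAll: "dep_atoms (DAll x \<phi>) = (\<lambda>(D, ys). (insert x D, ys)) ` dep_atoms \<phi>"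
  by auto

lemma dep_atoms_foldr_DAll [simp]:
  "dep_atoms (foldr DAll xs \<psi>) = (\<lambda>(D, ys). (set xs \<union> D, ys)) ` dep_atoms \<psi>"
  by (induction xs) (simp_all add: dep_atoms_DAll image_image split_beta del: dep_atoms.simps)

lemma dep_atoms_foldr_DExB [simp]:
  "dep_atoms (foldr DExB bs \<psi>) = dep_atoms \<psi>"
  by (induction bs) auto

lemma dep_atoms_foldr_DAnd [simp]:
  "dep_atoms (foldr DAnd \<delta>s \<psi>) = (\<Union>\<delta>\<in>set \<delta>s. dep_atoms \<delta>) \<union> dep_atoms \<psi>"
  by (induction \<delta>s) auto

lemma bounded_foldr_DAll [simp]:
  "bounded G (foldr DAll xs \<psi>) \<longleftrightarrow> bounded (rev xs @ G) \<psi>"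
  by (induction xs arbitrary: G) auto

lemma bounded_foldr_DExB [simp]:
  "bounded G (foldr DExB bs \<psi>) \<longleftrightarrow> bounded G \<psi>"
  by (induction bs) auto

lemma bounded_foldr_DAnd [simp]:
  "bounded G (foldr DAnd \<delta>s \<psi>) \<longleftrightarrow> (\<forall>\<delta>\<in>set \<delta>s. bounded G \<delta>) \<and> bounded G \<psi>"
  by (induction \<delta>s) auto

lemma bd_formula_bd_of_poc: "poc_formula \<tau> \<phi> \<Longrightarrow> bd_formula \<tau> (bd_of_poc n \<rho> \<phi>)"
  by (induction \<phi> arbitrary: n \<rho>) (auto simp: Let_def)

lemma set_poc_vars: "set (poc_vars ts) = (\<Union>t\<in>set ts. set (fst t))"
  by (auto simp: poc_vars_def)

lemma shift_image:
  "shift n (set (poc_vars ts)) \<rho> ` S \<subseteq>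
     {n..<n + Suc (sum_list (poc_vars ts))} \<union> \<rho> ` (S - set (poc_vars ts))"
  using poc_vars_less[of _ ts] by (auto simp: shift_def)

text \<open>The names \<open>1, ..., n - 1\<close> enter through the extra arguments of the atoms,
  even where the source formula does not mention them. For a sentence \<open>n\<close> is 1 and this
  interval is empty.\<close>

lemma bd_free_fo_bd_of_poc:
  "n > 0 \<Longrightarrow> bd_free_fo (bd_of_poc n \<rho> \<phi>) \<subseteq> {1..<n} \<union> \<rho> ` poc_free_fo \<phi>"
proof (induction \<phi> arbitrary: n \<rho>)
  case (PAll x \<phi>)
  have "bd_free_fo (bd_of_poc (Suc n) (\<rho>(x := n)) \<phi>) \<subseteq> {1..<Suc n} \<union> (\<rho>(x := n)) ` poc_free_fo \<phi>"
    by (rule PAll.IH) simp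
  moreover have "{1..<Suc n} - {n} = {1..<n}" using PAll.prems by auto
  moreover have "(\<rho>(x := n)) ` poc_free_fo \<phi> - {n} \<subseteq> \<rho> ` (poc_free_fo \<phi> - {x})" by auto
  ultimately show ?case unfolding bd_of_poc.simps bd_free_fo.simps poc_free_fo.simps by blast
next
  case (PEx x \<phi>)
  have "bd_free_fo (bd_of_poc (Suc n) (\<rho>(x := n)) \<phi>) \<subseteq> {1..<Suc n} \<union> (\<rho>(x := n)) ` poc_free_fo \<phi>"
    by (rule PEx.IH) simp
  moreover have "{1..<Suc n} - {n} = {1..<n}" using PEx.prems by auto
  moreover have "(\<rho>(x := n)) ` poc_free_fo \<phi> - {n} \<subseteq> \<rho> ` (poc_free_fo \<phi> - {x})" by auto
  ultimately show ?case unfolding bd_of_poc.simps bd_free_fo.simps poc_free_fo.simps by blast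
next
  case (PPoc ts \<phi>)
  let ?V = "set (poc_vars ts)" and ?k = "Suc (sum_list (poc_vars ts))"
  let ?\<rho>' = "shift n ?V \<rho>"
  have body: "bd_free_fo (bd_of_poc (n + ?k) ?\<rho>' \<phi>) - {n..<n + ?k} \<subseteq> {1..<n} \<union> \<rho> ` (poc_free_fo \<phi> - ?V)"
  proof -
    have "bd_free_fo (bd_of_poc (n + ?k) ?\<rho>' \<phi>) \<subseteq> {1..<n + ?k} \<union> ?\<rho>' ` poc_free_fo \<phi>"
      using PPoc.IH[of "n + ?k" ?\<rho>'] by simp
    moreover have "{1..<n + ?k} \<subseteq> {1..<n} \<union> {n..<n + ?k}" by auto
    ultimately show ?thesis using shift_image[of n ts \<rho> "poc_free_fo \<phi>"] by blast
  qed
  have "?\<rho>' ` set (fst t) \<subseteq> {n..<n + ?k}" if "t \<in> set ts" for t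
    using shift_image[of n ts \<rho> "set (fst t)"] that by (auto simp: set_poc_vars)
  then have args: "(\<Union>t\<in>set ts. {1..<n} \<union> ?\<rho>' ` set (fst t)) - {n..<n + ?k} \<subseteq> {1..<n}"
    by auto
  have "bd_free_fo (bd_of_poc n \<rho> (PPoc ts \<phi>)) =
      (\<Union>t\<in>set ts. {1..<n} \<union> ?\<rho>' ` set (fst t)) \<union> bd_free_fo (bd_of_poc (n + ?k) ?\<rho>' \<phi>) - {n..<n + ?k}"
    by (simp add: Let_def split_beta del: upt_Suc)
  moreover have "poc_free_fo (PPoc ts \<phi>) = poc_free_fo \<phi> - ?V" by (simp add: set_poc_vars)
  ultimately have eqs: "bd_free_fo (bd_of_poc n \<rho> (PPoc ts \<phi>)) =
      ((\<Union>t\<in>set ts. {1..<n} \<union> ?\<rho>' ` set (fst t)) - {n..<n + ?k}) \<union>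
      (bd_free_fo (bd_of_poc (n + ?k) ?\<rho>' \<phi>) - {n..<n + ?k})"
    "poc_free_fo (PPoc ts \<phi>) = poc_free_fo \<phi> - ?V"
    by (simp_all only: Un_Diff)
  show ?case unfolding eqs
    by (rule Un_least[OF order_trans[OF args Un_upper1] body])
next
  case (POr \<phi> \<psi>)
  from POr.IH[OF POr.prems] show ?case by (simp add: image_Un) blast
next
  case (PAnd \<phi> \<psi>)
  from PAnd.IH[OF PAnd.prems] show ?case by (simp add: image_Un) blast
qed auto

lemma bd_free_bool_bd_of_poc: "bd_free_bool (bd_of_poc n \<rho> \<phi>) = poc_free_bool \<phi>"
  by (induction \<phi> arbitrary: n \<rho>) (force simp: Let_def)+

text \<open>Every quantifier produced binds a name that is at least \<open>n\<close>, and an atom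
  lists all names below the level at which it is created, which never drops below
  \<open>n\<close>.\<close>

lemma dep_atoms_bd_of_poc:
  "(D, xs) \<in> dep_atoms (bd_of_poc n \<rho> \<phi>) \<Longrightarrow> {1..<n} \<subseteq> set xs \<and> D \<inter> {1..<n} = {}"
proof (induction \<phi> arbitrary: n \<rho> D)
  case (PPoc ts \<phi>)
  let ?k = "Suc (sum_list (poc_vars ts))"
  from PPoc.prems consider
    D' where "D = {n..<n + ?k} \<union> D'"
      "(D', xs) \<in> dep_atoms (bd_of_poc (n + ?k) (shift n (set (poc_vars ts)) \<rho>) \<phi>)" |
    "D = {n..<n + ?k}" "{1..<n} \<subseteq> set xs"
    by (fastforce simp: Let_def)
  then show ?case
  proof cases
    case 1
    with PPoc.IH[OF 1(2)] show ?thesis by auto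
  qed auto
qed (fastforce+)

text \<open>\<open>bounded\<close> puts the newest name in front, hence the reversal. At
  \<open>DEx\<close> its conditions are \<open>dep_atoms_bd_of_poc\<close> at level
  \<open>Suc n\<close> and the distinctness of an interval.\<close>

lemma bounded_bd_of_poc: "n > 0 \<Longrightarrow> bounded (rev [1..<n]) (bd_of_poc n \<rho> \<phi>)"
proof (induction \<phi> arbitrary: n \<rho>)
  case (PAll x \<phi>)
  have "rev [1..<Suc n] = n # rev [1..<n]" using PAll.prems by simp
  with PAll.IH[of "Suc n" "\<rho>(x := n)"] show ?case by (simp only: bd_of_poc.simps bounded.simps)
next
  case (PEx x \<phi>)
  have "{1..<Suc n} \<subseteq> set xs \<and> D \<inter> {1..<Suc n} = {}"
    if "(D, xs) \<in> dep_atoms (bd_of_poc (Suc n) (\<rho>(x := n)) \<phi>)" for D xs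
    by (rule dep_atoms_bd_of_poc) (rule that)
  moreover have "set (n # rev [1..<n]) = {1..<Suc n}" using PEx.prems by auto
  moreover have "distinct (n # rev [1..<n])" by simp
  moreover have "bounded (n # rev [1..<n]) (bd_of_poc (Suc n) (\<rho>(x := n)) \<phi>)"
  proof -
    have "rev [1..<Suc n] = n # rev [1..<n]" using PEx.prems by simp
    with PEx.IH[of "Suc n" "\<rho>(x := n)"] show ?thesis by (simp only:)
  qed
  ultimately show ?case unfolding bd_of_poc.simps bounded.simps by blast
next
  case (PPoc ts \<phi>)
  let ?k = "Suc (sum_list (poc_vars ts))"
  have "rev [n..<n + ?k] @ rev [1..<n] = rev [1..<n + ?k]"
    using upt_add_eq_append[of 1 n ?k] PPoc.prems by simp
  then show ?case using PPoc.IH[of "n + ?k"] PPoc.prems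
    by (auto simp: Let_def simp del: upt_Suc rev_append)
qed auto

text \<open>The variables in scope determine the assignment, including its Boolean part.\<close>

definition separates :: "fovar set \<Rightarrow> ((fovar \<Rightarrow> 'a) \<times> 'b) set \<Rightarrow> bool" where
  "separates S X \<longleftrightarrow> (\<forall>p\<in>X. \<forall>q\<in>X. (\<forall>x\<in>S. fst p x = fst q x) \<longrightarrow> p = q)"

section \<open>Correctness on separated teams\<close>

lemma separates_subset: "separates S X \<Longrightarrow> Y \<subseteq> X \<Longrightarrow> separates S Y"
  unfolding separates_def by blast

text \<open>Passage from a team to an extension of it: the new member \<open>y i\<close> agrees on
  \<open>S\<close> with the old member \<open>\<pi> i\<close>, so \<open>S\<close> identifies the
  old member, and \<open>T\<close> tells apart the new members that stem from it.\<close>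

lemma separates_image:
  assumes "separates S X" and X: "\<And>i. i \<in> I \<Longrightarrow> \<pi> i \<in> X"
    and S: "\<And>i x. i \<in> I \<Longrightarrow> x \<in> S \<Longrightarrow> fst (y i) x = fst (\<pi> i) x"
    and T: "\<And>i j. \<lbrakk>i \<in> I; j \<in> I; \<pi> i = \<pi> j; \<forall>x\<in>T. fst (y i) x = fst (y j) x\<rbrakk> \<Longrightarrow> y i = y j"
  shows "separates (S \<union> T) (y ` I)"
  unfolding separates_def
proof (intro ballI impI, elim imageE)
  fix p q i j assume *: "\<forall>x\<in>S \<union> T. fst p x = fst q x" "p = y i" "i \<in> I" "q = y j" "j \<in> I"
  then have "\<forall>x\<in>S. fst (\<pi> i) x = fst (\<pi> j) x"
    using S[OF \<open>i \<in> I\<close>] S[OF \<open>j \<in> I\<close>] by simp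
  then have "\<pi> i = \<pi> j" using assms(1) X * unfolding separates_def by blast
  then show "p = q" using T[of i j] * by simp
qed

lemma tsat_foldr_DAll:
  assumes "univ M \<noteq> {}"
  shows "tsat M (foldr DAll xs \<psi>) X \<longleftrightarrow>
    tsat M \<psi> ((\<lambda>(p, g). (override_on (fst p) g (set xs), snd p)) ` (X \<times> {g. range g \<subseteq> univ M}))"
  by (simp add: tsat_def fsat_foldr_DAll[OF assms])

lemma tsat_foldr_DExB:
  "tsat M (foldr DExB bs \<psi>) X \<longleftrightarrow>
     (\<exists>H. tsat M \<psi> ((\<lambda>p. (fst p, override_on (snd p) (H p) (set bs))) ` X))"
proof -
  have "tsat M (foldr DExB bs \<psi>) X \<longleftrightarrow>
      (\<exists>f H. \<forall>p\<in>X. fsat M \<psi> f (fst p) (override_on (snd p) (H p) (set bs)))"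
    unfolding tsat_def fsat_foldr_DExB bchoice_iff ..
  then show ?thesis by (simp add: tsat_def del: split_paired_Ex) (rule ex_comm)
qed

lemma fun_upd_comp_fresh:
  "(\<And>y. \<rho> y \<noteq> n) \<Longrightarrow> (v(n := a)) \<circ> (\<rho>(x := n)) = (v \<circ> \<rho>)(x := a)"
  by (auto simp: fun_eq_iff)

lemma tup_eq:
  assumes "distinct (map snd ts)" "(xs, \<alpha>) \<in> set ts"
  shows "tup ts \<alpha> = set xs"
proof -
  obtain i where "i < length ts" "ts ! i = (xs, \<alpha>)" using assms(2) by (auto simp: in_set_conv_nth)
  then show ?thesis using tup_nth[OF assms(1), of i] by simp
qed

text \<open>On separated teams the translation is flat, that is, decided member by member.
  Separation lets the functions found at single members be combined into one function per atom, and
  it persists because every newly quantified name joins the interval.\<close>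

lemma bd_of_poc_correct:
  fixes M :: "('r, 'a) struct"
  assumes ne: "univ M \<noteq> {}" and "n > 0" "\<And>y. \<rho> y < n" "poc_formula \<tau> \<phi>" "separates {1..<n} X"
  shows "tsat M (bd_of_poc n \<rho> \<phi>) X \<longleftrightarrow> (\<forall>p\<in>X. psat M \<phi> (fst p \<circ> \<rho>) (snd p))"
  using assms(2-)
proof (induction \<phi> arbitrary: n \<rho> X)
  case (POr \<phi> \<psi>)
  have IH: "tsat M (bd_of_poc n \<rho> \<phi>) Y \<longleftrightarrow> (\<forall>p\<in>Y. psat M \<phi> (fst p \<circ> \<rho>) (snd p))"
    "tsat M (bd_of_poc n \<rho> \<psi>) Y \<longleftrightarrow> (\<forall>p\<in>Y. psat M \<psi> (fst p \<circ> \<rho>) (snd p))" if "Y \<subseteq> X" for Y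
    using POr.prems separates_subset[OF POr.prems(4) that] by (intro POr.IH; simp)+
  show ?case
  proof
    assume "tsat M (bd_of_poc n \<rho> (POr \<phi> \<psi>)) X"
    then obtain Y Z where "X = Y \<union> Z" "tsat M (bd_of_poc n \<rho> \<phi>) Y" "tsat M (bd_of_poc n \<rho> \<psi>) Z"
      unfolding bd_of_poc.simps tsat_DOr by blast
    then show "\<forall>p\<in>X. psat M (POr \<phi> \<psi>) (fst p \<circ> \<rho>) (snd p)" using IH by auto
  next
    assume *: "\<forall>p\<in>X. psat M (POr \<phi> \<psi>) (fst p \<circ> \<rho>) (snd p)"
    let ?Y = "{p\<in>X. psat M \<phi> (fst p \<circ> \<rho>) (snd p)}" and ?Z = "{p\<in>X. psat M \<psi> (fst p \<circ> \<rho>) (snd p)}"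
    have "X = ?Y \<union> ?Z" using * by auto
    moreover have "tsat M (bd_of_poc n \<rho> \<phi>) ?Y" by (subst IH) auto
    moreover have "tsat M (bd_of_poc n \<rho> \<psi>) ?Z" by (subst IH) auto
    ultimately show "tsat M (bd_of_poc n \<rho> (POr \<phi> \<psi>)) X"
      unfolding bd_of_poc.simps tsat_DOr by (intro exI conjI)
  qed
next
  case (PAnd \<phi> \<psi>)
  then show ?case by (auto simp: tsat_DAnd)
next
  case (PAll x \<phi>)
  let ?Y = "(\<lambda>(p, a). ((fst p)(n := a), snd p)) ` (X \<times> univ M)"
  have "separates ({1..<n} \<union> {n}) ?Y"
    by (rule separates_image[OF PAll.prems(4), where \<pi> = fst]) (auto split: prod.splits)
  moreover have "{1..<n} \<union> {n} = {1..<Suc n}" using PAll.prems by auto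
  ultimately have "tsat M (bd_of_poc (Suc n) (\<rho>(x := n)) \<phi>) ?Y \<longleftrightarrow>
      (\<forall>q\<in>?Y. psat M \<phi> (fst q \<circ> \<rho>(x := n)) (snd q))"
    using PAll.prems less_SucI by (intro PAll.IH) auto
  moreover have "\<And>y. \<rho> y \<noteq> n" using PAll.prems(2) less_irrefl by metis
  ultimately show ?case
    unfolding bd_of_poc.simps tsat_DAll psat.simps by (simp add: fun_upd_comp_fresh)
next
  case (PEx x \<phi>)
  have fresh: "\<And>y. \<rho> y \<noteq> n" using PEx.prems(2) less_irrefl by metis
  have "tsat M (bd_of_poc (Suc n) (\<rho>(x := n)) \<phi>) ((\<lambda>p. ((fst p)(n := H p), snd p)) ` X) \<longleftrightarrow>
      (\<forall>p\<in>X. psat M \<phi> ((fst p \<circ> \<rho>)(x := H p)) (snd p))" for H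
  proof -
    let ?Y = "(\<lambda>p. ((fst p)(n := H p), snd p)) ` X"
    have "separates ({1..<n} \<union> {n}) ?Y"
      by (rule separates_image[OF PEx.prems(4), where \<pi> = id]) (auto split: prod.splits)
    moreover have "{1..<n} \<union> {n} = {1..<Suc n}" using PEx.prems by auto
    ultimately have "tsat M (bd_of_poc (Suc n) (\<rho>(x := n)) \<phi>) ?Y \<longleftrightarrow>
        (\<forall>q\<in>?Y. psat M \<phi> (fst q \<circ> \<rho>(x := n)) (snd q))"
      using PEx.prems less_SucI by (intro PEx.IH) auto
    then show ?thesis by (simp add: fun_upd_comp_fresh[OF fresh])
  qed
  then show ?case
    unfolding bd_of_poc.simps tsat_DEx psat.simps Bex_def bchoice_iff by (simp add: ball_conj_distrib)
next
  case (PPoc ts \<phi>)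
  note n = PPoc.prems(1) and \<rho> = PPoc.prems(2) and sep = PPoc.prems(4)
  define V where "V = set (poc_vars ts)"
  define k where "k = Suc (sum_list (poc_vars ts))"
  define \<rho>' where "\<rho>' = shift n V \<rho>"
  define G where "G = {g :: fovar \<Rightarrow> 'a. range g \<subseteq> univ M}"
  define w where "w v g = override_on v g {n..<n + k}" for v g :: "fovar \<Rightarrow> 'a"
  define Z where "Z = (\<lambda>(p, g). (w (fst p) g, snd p)) ` (X \<times> G)"
  define Y where "Y H = (\<lambda>z. (fst z, override_on (snd z) (H z) (snd ` set ts))) ` Z" for H
  let ?deps = "map (\<lambda>(xs, \<alpha>). DDep ([1..<n] @ map \<rho>' xs) \<alpha>) ts"
  have dist: "distinct (map snd ts)" and wf: "poc_formula \<tau> \<phi>" using PPoc.prems by auto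
  have V: "V = set (concat (map fst ts))" by (simp add: V_def poc_vars_def)
  have tupV: "tup ts \<alpha> \<subseteq> V" for \<alpha> by (force simp: V tup_def)
  have less: "n + x < n + k" if "x \<in> V" for x using poc_vars_less that by (simp add: V_def k_def)
  have \<rho>'_less: "\<rho>' y < n + k" for y using less \<rho>[of y] by (simp add: \<rho>'_def shift_def)
  have w_\<rho>': "w v g \<circ> \<rho>' = override_on (v \<circ> \<rho>) (\<lambda>x. g (n + x)) V" for v g
  proof
    fix x
    show "(w v g \<circ> \<rho>') x = override_on (v \<circ> \<rho>) (\<lambda>x. g (n + x)) V x"
      using less[of x] \<rho>[of x] by (simp add: w_def \<rho>'_def shift_def override_on_def)
  qed
  have "separates ({1..<n} \<union> {n..<n + k}) Z"
    unfolding Z_def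
    by (rule separates_image[OF sep, where \<pi> = fst]) (auto simp: w_def override_on_def fun_eq_iff)
  moreover have "{1..<n} \<union> {n..<n + k} = {1..<n + k}" using n by auto
  ultimately have "separates {1..<n + k} Z" by simp
  \<comment> \<open>The Boolean values given by \<open>H\<close> are a function of the old member,
    so no further name is needed to separate the new ones.\<close>
  then have "separates ({1..<n + k} \<union> {}) (Y H)" for H
    unfolding Y_def by (rule separates_image[where \<pi> = id]) auto
  then have IH: "tsat M (bd_of_poc (n + k) \<rho>' \<phi>) (Y H) \<longleftrightarrow>
      (\<forall>q\<in>Y H. psat M \<phi> (fst q \<circ> \<rho>') (snd q))" for H
    using n wf \<rho>'_less by (intro PPoc.IH) auto
  have "bd_of_poc n \<rho> (PPoc ts \<phi>) = foldr DAll [n..<n + k] (foldr DExB (map snd ts)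
      (foldr DAnd ?deps (bd_of_poc (n + k) \<rho>' \<phi>)))"
    by (simp only: bd_of_poc.simps Let_def V_def k_def \<rho>'_def)
  then have lhs: "tsat M (bd_of_poc n \<rho> (PPoc ts \<phi>)) X \<longleftrightarrow> (\<exists>H.
      (\<forall>(xs, \<alpha>)\<in>set ts. tsat M (DDep ([1..<n] @ map \<rho>' xs) \<alpha>) (Y H)) \<and>
      (\<forall>q\<in>Y H. psat M \<phi> (fst q \<circ> \<rho>') (snd q)))"
    by (simp add: tsat_foldr_DAll[OF ne] tsat_foldr_DExB tsat_foldr_DAnd IH
        flip: G_def w_def Z_def Y_def) (simp add: split_beta)
  have rhs: "psat M (PPoc ts \<phi>) v b \<longleftrightarrow> (\<exists>F. \<forall>g\<in>G.
      psat M \<phi> (override_on v g V) (bext ts F (override_on v g V) b))" for v b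
    by (simp add: V G_def)
  show ?case unfolding lhs rhs
  proof (intro iffI ballI; (elim exE conjE)?)
    fix H p assume deps: "\<forall>(xs, \<alpha>)\<in>set ts. tsat M (DDep ([1..<n] @ map \<rho>' xs) \<alpha>) (Y H)"
      and sat: "\<forall>q\<in>Y H. psat M \<phi> (fst q \<circ> \<rho>') (snd q)" and p: "p \<in> X"
    have "\<forall>\<alpha>\<in>snd ` set ts. \<exists>h. \<forall>q\<in>Y H. snd q \<alpha> = h (restrict (fst q) ({1..<n} \<union> \<rho>' ` tup ts \<alpha>))"
    proof (intro ballI, elim imageE)
      fix \<alpha> t assume t: "\<alpha> = snd t" "t \<in> set ts"
      then have "tsat M (DDep ([1..<n] @ map \<rho>' (fst t)) \<alpha>) (Y H)" using deps by auto
      moreover have "set ([1..<n] @ map \<rho>' (fst t)) = {1..<n} \<union> \<rho>' ` tup ts \<alpha>"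
        using tup_eq[OF dist, of "fst t" \<alpha>] t by simp
      ultimately show "\<exists>h. \<forall>q\<in>Y H. snd q \<alpha> = h (restrict (fst q) ({1..<n} \<union> \<rho>' ` tup ts \<alpha>))"
        unfolding tsat_DDep dependence_function by simp
    qed
    then obtain h where h: "\<And>\<alpha> q. \<lbrakk>\<alpha> \<in> snd ` set ts; q \<in> Y H\<rbrakk> \<Longrightarrow>
        snd q \<alpha> = h \<alpha> (restrict (fst q) ({1..<n} \<union> \<rho>' ` tup ts \<alpha>))"
      unfolding bchoice_iff by blast
    \<comment> \<open>The function of the atom is specialised to \<open>p\<close>: arguments below
      \<open>n\<close> are frozen at their values in \<open>p\<close>, and \<open>y - n\<close>
      undoes the shift of the tuple variables.\<close>
    define F where "F \<alpha> u = h \<alpha> (restrict (\<lambda>y. if y < n then fst p y else u (y - n))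
        ({1..<n} \<union> \<rho>' ` tup ts \<alpha>))" for \<alpha> u
    show "\<exists>F. \<forall>g\<in>G. psat M \<phi> (override_on (fst p \<circ> \<rho>) g V)
        (bext ts F (override_on (fst p \<circ> \<rho>) g V) (snd p))"
    proof (intro exI[of _ F] ballI)
      fix g assume g: "g \<in> G"
      let ?u = "override_on (fst p \<circ> \<rho>) g V" and ?g = "\<lambda>y. g (y - n)"
      have g': "?g \<in> G" using g by (auto simp: G_def)
      let ?z = "(w (fst p) ?g, snd p)"
      let ?q = "(fst ?z, override_on (snd ?z) (H ?z) (snd ` set ts))"
      have q: "?q \<in> Y H" unfolding Y_def Z_def using p g' by force
      have u: "fst ?q \<circ> \<rho>' = ?u" by (simp add: w_\<rho>')
      have "bext ts F ?u (snd p) = snd ?q"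
      proof
        fix \<alpha>
        show "bext ts F ?u (snd p) \<alpha> = snd ?q \<alpha>"
        proof (cases "\<alpha> \<in> snd ` set ts")
          case True
          have "restrict (\<lambda>y. if y < n then fst p y else restrict ?u (tup ts \<alpha>) (y - n))
              ({1..<n} \<union> \<rho>' ` tup ts \<alpha>) = restrict (fst ?q) ({1..<n} \<union> \<rho>' ` tup ts \<alpha>)"
          proof (rule restrict_ext, elim UnE imageE)
            fix y x assume "y = \<rho>' x" "x \<in> tup ts \<alpha>"
            then show "(if y < n then fst p y else restrict ?u (tup ts \<alpha>) (y - n)) = fst ?q y"
              using tupV[of \<alpha>] less[of x] by (auto simp: \<rho>'_def shift_def w_def override_on_def)
          qed (simp add: w_def)
          then show ?thesis using h[OF True q] True by (simp add: bext_def F_def)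
        qed (simp add: bext_def)
      qed
      then show "psat M \<phi> ?u (bext ts F ?u (snd p))" using bspec[OF sat q] u by simp
    qed
  next
    assume "\<forall>p\<in>X. \<exists>F. \<forall>g\<in>G. psat M \<phi> (override_on (fst p \<circ> \<rho>) g V)
        (bext ts F (override_on (fst p \<circ> \<rho>) g V) (snd p))"
    then obtain F where F: "\<And>p g. \<lbrakk>p \<in> X; g \<in> G\<rbrakk> \<Longrightarrow> psat M \<phi> (override_on (fst p \<circ> \<rho>) g V)
        (bext ts (F p) (override_on (fst p \<circ> \<rho>) g V) (snd p))"
      unfolding bchoice_iff by blast
    \<comment> \<open>The quantified interval starts at \<open>n\<close>, so the names below it are
      untouched and, by separation, identify the member of \<open>X\<close> from which a valuation
      arises.\<close>
    define orig where "orig v = (THE p. p \<in> X \<and> (\<forall>x\<in>{1..<n}. fst p x = v x))" for v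
    have orig: "orig (w (fst p) g) = p" if "p \<in> X" for p g
      unfolding orig_def
    proof (rule the_equality)
      show "p \<in> X \<and> (\<forall>x\<in>{1..<n}. fst p x = w (fst p) g x)" using that by (simp add: w_def)
      fix q assume "q \<in> X \<and> (\<forall>x\<in>{1..<n}. fst q x = w (fst p) g x)"
      then show "q = p" using sep that unfolding separates_def by (simp add: w_def)
    qed
    have orig_cong: "orig v = orig v'" if "\<And>x. x \<in> {1..<n} \<Longrightarrow> v x = v' x" for v v'
      using that by (simp add: orig_def)
    \<comment> \<open>Each member of \<open>X\<close> uses its own functions \<open>F p\<close>. The
      value depends on the names below \<open>n\<close>, through \<open>orig\<close>, and on the
      tuple of \<open>\<alpha>\<close>: exactly the arguments of the atom.\<close>
    define H where "H z = (\<lambda>\<alpha>. F (orig (fst z)) \<alpha> (restrict (fst z \<circ> \<rho>') (tup ts \<alpha>)))" for z :: "(nat \<Rightarrow> 'a) \<times> (nat \<Rightarrow> bool)"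
    have "tsat M (DDep ([1..<n] @ map \<rho>' xs) \<alpha>) (Y H)" if "(xs, \<alpha>) \<in> set ts" for xs \<alpha>
      unfolding tsat_DDep
    proof (intro ballI impI)
      fix q q' assume qq: "q \<in> Y H" "q' \<in> Y H"
        and eq: "\<forall>x\<in>set ([1..<n] @ map \<rho>' xs). fst q x = fst q' x"
      have snd: "snd r \<alpha> = F (orig (fst r)) \<alpha> (restrict (fst r \<circ> \<rho>') (tup ts \<alpha>))" if r: "r \<in> Y H" for r
      proof -
        obtain z where "r = (fst z, override_on (snd z) (H z) (snd ` set ts))"
          using r unfolding Y_def by blast
        moreover have "\<alpha> \<in> snd ` set ts" using \<open>(xs, \<alpha>) \<in> set ts\<close> by force
        ultimately show ?thesis by (simp add: H_def)
      qed
      have "orig (fst q) = orig (fst q')" using eq by (intro orig_cong) simp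
      moreover have "restrict (fst q \<circ> \<rho>') (tup ts \<alpha>) = restrict (fst q' \<circ> \<rho>') (tup ts \<alpha>)"
        using eq by (simp add: restrict_eq_iff tup_eq[OF dist that])
      ultimately show "snd q \<alpha> = snd q' \<alpha>" using qq by (simp add: snd)
    qed
    moreover have "psat M \<phi> (fst q \<circ> \<rho>') (snd q)" if "q \<in> Y H" for q
    proof -
      from that obtain p g where p: "p \<in> X" "g \<in> G" and q: "q = (w (fst p) g,
          override_on (snd p) (H (w (fst p) g, snd p)) (snd ` set ts))"
        by (auto simp: Y_def Z_def)
      let ?g = "\<lambda>x. g (n + x)"
      have "?g \<in> G" using p by (auto simp: G_def)
      then have "psat M \<phi> (override_on (fst p \<circ> \<rho>) ?g V)
          (bext ts (F p) (override_on (fst p \<circ> \<rho>) ?g V) (snd p))" using F p by blast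
      moreover have "bext ts (F p) (override_on (fst p \<circ> \<rho>) ?g V) (snd p) = snd q"
        by (auto simp: bext_def q H_def orig[OF p(1)] w_\<rho>' override_on_def)
      ultimately show ?thesis by (simp add: q w_\<rho>')
    qed
    ultimately show "\<exists>H. (\<forall>(xs, \<alpha>)\<in>set ts. tsat M (DDep ([1..<n] @ map \<rho>' xs) \<alpha>) (Y H)) \<and>
      (\<forall>q\<in>Y H. psat M \<phi> (fst q \<circ> \<rho>') (snd q))" by blast
  qed
qed (auto simp: tsat_def comp_def)

section \<open>From dependence atoms to partially-ordered connectives\<close>

text \<open>The translation of an occurrence of \<open>\<phi>\<close> uses the names \<open>n, \<dots>, n + width \<phi> - 1\<close>
  for both kinds of variables.\<close>

primrec width :: "'r bd \<Rightarrow> nat" where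
  "width (DEq x y) = 0"
| "width (DNeq x y) = 0"
| "width (DBool \<alpha>) = 0"
| "width (DNBool \<alpha>) = 0"
| "width (DDep xs \<alpha>) = 1"
| "width (DRel R xs) = 0"
| "width (DNRel R xs) = 0"
| "width (DOr \<phi> \<psi>) = width \<phi> + width \<psi>"
| "width (DAnd \<phi> \<psi>) = width \<phi> + width \<psi>"
| "width (DAll x \<phi>) = Suc (width \<phi>)"
| "width (DEx x \<phi>) = Suc (width \<phi>)"
| "width (DExB \<alpha> \<phi>) = Suc (width \<phi>)"

text \<open>\<open>sc\<close> lists the variables in scope; they are the arguments of the Skolem function for
  \<open>\<exists>\<alpha>\<close>.\<close>

primrec entries :: "(fovar \<Rightarrow> fovar) \<Rightarrow> fovar list \<Rightarrow> nat \<Rightarrow> 'r bd \<Rightarrow> (fovar list \<times> bvar) list" where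
  "entries \<rho> sc n (DEq x y) = []"
| "entries \<rho> sc n (DNeq x y) = []"
| "entries \<rho> sc n (DBool \<alpha>) = []"
| "entries \<rho> sc n (DNBool \<alpha>) = []"
| "entries \<rho> sc n (DDep xs \<alpha>) = [(map \<rho> xs, n)]"
| "entries \<rho> sc n (DRel R xs) = []"
| "entries \<rho> sc n (DNRel R xs) = []"
| "entries \<rho> sc n (DOr \<phi> \<psi>) = entries \<rho> sc n \<phi> @ entries \<rho> sc (n + width \<phi>) \<psi>"
| "entries \<rho> sc n (DAnd \<phi> \<psi>) = entries \<rho> sc n \<phi> @ entries \<rho> sc (n + width \<phi>) \<psi>"
| "entries \<rho> sc n (DAll x \<phi>) = entries (\<rho>(x := n)) (n # sc) (Suc n) \<phi>"
| "entries \<rho> sc n (DEx x \<phi>) = []"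
| "entries \<rho> sc n (DExB \<alpha> \<phi>) = (sc, n) # entries \<rho> sc (Suc n) \<phi>"

text \<open>The first entry is a dummy that lets the connective bind all fresh variables; variables up to
  \<open>n\<close> are parameters and must not be bound again.\<close>

definition block :: "nat \<Rightarrow> nat \<Rightarrow> (fovar list \<times> bvar) list \<Rightarrow> (fovar list \<times> bvar) list" where
  "block n k E = ([Suc n..<Suc n + k], n) # map (\<lambda>(xs, \<beta>). (filter (\<lambda>x. n < x) xs, \<beta>)) E"

text \<open>What remains of a formula once its functions and universal quantifiers have moved to the
  enclosing connective: \<open>DAll\<close> and \<open>DExB\<close> leave only a renaming to
  \<open>n\<close>, and a dependence atom becomes the equivalence of its Boolean variable with the
  value \<open>n\<close> of its function. \<open>DEx\<close> starts a new connective for everything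
  below it.\<close>

primrec matrix :: "(fovar \<Rightarrow> fovar) \<Rightarrow> (bvar \<Rightarrow> bvar) \<Rightarrow> fovar list \<Rightarrow> nat \<Rightarrow> 'r bd \<Rightarrow> 'r poc" where
  "matrix \<rho> \<sigma> sc n (DEq x y) = PEq (\<rho> x) (\<rho> y)"
| "matrix \<rho> \<sigma> sc n (DNeq x y) = PNeq (\<rho> x) (\<rho> y)"
| "matrix \<rho> \<sigma> sc n (DBool \<alpha>) = PBool (\<sigma> \<alpha>)"
| "matrix \<rho> \<sigma> sc n (DNBool \<alpha>) = PNBool (\<sigma> \<alpha>)"
| "matrix \<rho> \<sigma> sc n (DDep xs \<alpha>) =
     POr (PAnd (PBool (\<sigma> \<alpha>)) (PBool n)) (PAnd (PNBool (\<sigma> \<alpha>)) (PNBool n))"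
| "matrix \<rho> \<sigma> sc n (DRel R xs) = PRel R (map \<rho> xs)"
| "matrix \<rho> \<sigma> sc n (DNRel R xs) = PNRel R (map \<rho> xs)"
| "matrix \<rho> \<sigma> sc n (DOr \<phi> \<psi>) = POr (matrix \<rho> \<sigma> sc n \<phi>) (matrix \<rho> \<sigma> sc (n + width \<phi>) \<psi>)"
| "matrix \<rho> \<sigma> sc n (DAnd \<phi> \<psi>) = PAnd (matrix \<rho> \<sigma> sc n \<phi>) (matrix \<rho> \<sigma> sc (n + width \<phi>) \<psi>)"
| "matrix \<rho> \<sigma> sc n (DAll x \<phi>) = matrix (\<rho>(x := n)) \<sigma> (n # sc) (Suc n) \<phi>"
| "matrix \<rho> \<sigma> sc n (DEx x \<phi>) =
     PEx n (PPoc (block n (width \<phi>) (entries (\<rho>(x := n)) (n # sc) (Suc n) \<phi>))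
       (matrix (\<rho>(x := n)) \<sigma> (n # sc) (Suc n) \<phi>))"
| "matrix \<rho> \<sigma> sc n (DExB \<alpha> \<phi>) = matrix \<rho> (\<sigma>(\<alpha> := n)) sc (Suc n) \<phi>"

section \<open>Names used by the converse translation\<close>

lemma entries_bvars: "snd ` set (entries \<rho> sc n \<phi>) \<subseteq> {n..<n + width \<phi>}"
proof (induction \<phi> arbitrary: \<rho> sc n)
  case (DOr \<phi> \<psi>)
  from DOr.IH(1)[of \<rho> sc n] DOr.IH(2)[of \<rho> sc "n + width \<phi>"] show ?case by (fastforce simp: image_Un)
next
  case (DAnd \<phi> \<psi>)
  from DAnd.IH(1)[of \<rho> sc n] DAnd.IH(2)[of \<rho> sc "n + width \<phi>"] show ?case by (fastforce simp: image_Un)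
next
  case (DAll x \<phi>)
  from DAll.IH[of "\<rho>(x := n)" "n # sc" "Suc n"] show ?case by fastforce
next
  case (DExB \<alpha> \<phi>)
  from DExB.IH[of \<rho> sc "Suc n"] show ?case by fastforce
qed auto

lemma entries_bvars_bounds:
  "\<beta> \<in> snd ` set (entries \<rho> sc n \<phi>) \<Longrightarrow> n \<le> \<beta> \<and> \<beta> < n + width \<phi>"
  using entries_bvars[of \<rho> sc n \<phi>] by auto

lemma distinct_entries: "distinct (map snd (entries \<rho> sc n \<phi>))"
proof (induction \<phi> arbitrary: \<rho> sc n)
  case (DOr \<phi> \<psi>)
  then show ?case by (auto dest!: entries_bvars_bounds[OF imageI])
next
  case (DAnd \<phi> \<psi>)
  then show ?case by (auto dest!: entries_bvars_bounds[OF imageI])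
next
  case (DExB \<alpha> \<phi>)
  then show ?case by (auto dest!: entries_bvars_bounds[OF imageI])
qed auto

lemma entries_fovars:
  "(xs, \<beta>) \<in> set (entries \<rho> sc n \<phi>) \<Longrightarrow> set xs \<subseteq> range \<rho> \<union> set sc \<union> {n..<n + width \<phi>}"
proof (induction \<phi> arbitrary: \<rho> sc n)
  case (DOr \<phi> \<psi>)
  then show ?case by fastforce
next
  case (DAnd \<phi> \<psi>)
  then show ?case by fastforce
next
  case (DAll x \<phi>)
  from DAll.IH[of "\<rho>(x := n)" "n # sc" "Suc n"] DAll.prems show ?case by fastforce
next
  case (DExB \<alpha> \<phi>)
  then show ?case by fastforce
qed auto

lemma tup_entries: "tup (entries \<rho> sc n \<phi>) \<beta> \<subseteq> range \<rho> \<union> set sc \<union> {n..<n + width \<phi>}"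
  using entries_fovars unfolding tup_def by blast

text \<open>Names that stem from \<open>DAll\<close> may stay free, to be bound by the enclosing
  connective; this accounts for the interval. Names below a \<open>DEx\<close> are bound by the
  connective opened there.\<close>

lemma poc_free_fo_matrix:
  "poc_free_fo (matrix \<rho> \<sigma> sc n \<phi>) \<subseteq> \<rho> ` bd_free_fo \<phi> \<union> {n..<n + width \<phi>}"
proof (induction \<phi> arbitrary: \<rho> \<sigma> sc n)
  case (DOr \<phi> \<psi>)
  have "{n..<n + width \<phi>} \<union> {n + width \<phi>..<n + width \<phi> + width \<psi>} \<subseteq> {n..<n + width (DOr \<phi> \<psi>)}"
    by auto
  with DOr.IH(1)[of \<rho> \<sigma> sc n] DOr.IH(2)[of \<rho> \<sigma> sc "n + width \<phi>"] show ?case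
    unfolding matrix.simps poc_free_fo.simps bd_free_fo.simps image_Un by blast
next
  case (DAnd \<phi> \<psi>)
  have "{n..<n + width \<phi>} \<union> {n + width \<phi>..<n + width \<phi> + width \<psi>} \<subseteq> {n..<n + width (DAnd \<phi> \<psi>)}"
    by auto
  with DAnd.IH(1)[of \<rho> \<sigma> sc n] DAnd.IH(2)[of \<rho> \<sigma> sc "n + width \<phi>"] show ?case
    unfolding matrix.simps poc_free_fo.simps bd_free_fo.simps image_Un by blast
next
  case (DAll x \<phi>)
  have "(\<rho>(x := n)) ` bd_free_fo \<phi> \<subseteq> insert n (\<rho> ` (bd_free_fo \<phi> - {x}))" by auto
  moreover have "insert n {Suc n..<Suc n + width \<phi>} \<subseteq> {n..<n + width (DAll x \<phi>)}" by auto
  ultimately show ?case using DAll.IH[of "\<rho>(x := n)" \<sigma> "n # sc" "Suc n"]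
    unfolding matrix.simps bd_free_fo.simps by blast
next
  case (DEx x \<phi>)
  have "(\<rho>(x := n)) ` bd_free_fo \<phi> \<subseteq> insert n (\<rho> ` (bd_free_fo \<phi> - {x}))" by auto
  moreover have "poc_free_fo (matrix \<rho> \<sigma> sc n (DEx x \<phi>)) \<subseteq>
      poc_free_fo (matrix (\<rho>(x := n)) \<sigma> (n # sc) (Suc n) \<phi>) - {Suc n..<Suc n + width \<phi>} - {n}"
    by (auto simp: block_def)
  ultimately show ?case using DEx.IH[of "\<rho>(x := n)" \<sigma> "n # sc" "Suc n"]
    unfolding bd_free_fo.simps by blast
next
  case (DExB \<alpha> \<phi>)
  have "{Suc n..<Suc n + width \<phi>} \<subseteq> {n..<n + width (DExB \<alpha> \<phi>)}" by auto
  with DExB.IH[of \<rho> "\<sigma>(\<alpha> := n)" sc "Suc n"] show ?case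
    unfolding matrix.simps bd_free_fo.simps by blast
qed auto

lemma block_bvars: "snd ` set (block n k E) = insert n (snd ` set E)"
  by (force simp: block_def)

lemma poc_free_bool_matrix:
  "poc_free_bool (matrix \<rho> \<sigma> sc n \<phi>) \<subseteq> \<sigma> ` bd_free_bool \<phi> \<union> snd ` set (entries \<rho> sc n \<phi>)"
proof (induction \<phi> arbitrary: \<rho> \<sigma> sc n)
  case (DOr \<phi> \<psi>)
  from DOr.IH(1)[of \<rho> \<sigma> sc n] DOr.IH(2)[of \<rho> \<sigma> sc "n + width \<phi>"] show ?case
    unfolding matrix.simps poc_free_bool.simps bd_free_bool.simps entries.simps set_append image_Un
    by blast
next
  case (DAnd \<phi> \<psi>)
  from DAnd.IH(1)[of \<rho> \<sigma> sc n] DAnd.IH(2)[of \<rho> \<sigma> sc "n + width \<phi>"] show ?case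
    unfolding matrix.simps poc_free_bool.simps bd_free_bool.simps entries.simps set_append image_Un
    by blast
next
  case (DAll x \<phi>)
  then show ?case by simp
next
  case (DEx x \<phi>)
  from DEx.IH[of "\<rho>(x := n)" \<sigma> "n # sc" "Suc n"] show ?case
    unfolding matrix.simps poc_free_bool.simps bd_free_bool.simps set_map block_bvars by blast
next
  case (DExB \<alpha> \<phi>)
  have "(\<sigma>(\<alpha> := n)) ` bd_free_bool \<phi> \<subseteq> insert n (\<sigma> ` (bd_free_bool \<phi> - {\<alpha>}))" by auto
  with DExB.IH[of \<rho> "\<sigma>(\<alpha> := n)" sc "Suc n"] show ?case
    unfolding matrix.simps bd_free_bool.simps entries.simps list.set image_insert snd_conv by blast
qed auto

lemma distinct_block: "distinct (map snd (block n k (entries \<rho> sc (Suc n) \<phi>)))"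
proof -
  have "map snd (block n k (entries \<rho> sc (Suc n) \<phi>)) = n # map snd (entries \<rho> sc (Suc n) \<phi>)"
    by (auto simp: block_def)
  moreover have "n \<notin> snd ` set (entries \<rho> sc (Suc n) \<phi>)"
    using entries_bvars_bounds by fastforce
  ultimately show ?thesis by (simp add: distinct_entries)
qed

lemma poc_formula_matrix: "bd_formula \<tau> \<phi> \<Longrightarrow> poc_formula \<tau> (matrix \<rho> \<sigma> sc n \<phi>)"
proof (induction \<phi> arbitrary: \<rho> \<sigma> sc n)
  case (DEx x \<phi>)
  then show ?case unfolding matrix.simps poc_formula.simps
    by (intro conjI distinct_block) (simp_all add: block_def)
qed auto

text \<open>Boundedness enters here, with \<open>K\<close> the variables in whose scope the innermost
  existential quantifier above the atoms lies.\<close>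

lemma entries_cover:
  assumes "\<forall>(D, xs)\<in>dep_atoms \<phi>. S \<subseteq> set xs \<and> S \<inter> D = {}"
    and "dep_atoms \<phi> \<noteq> {} \<Longrightarrow> K \<subseteq> \<rho> ` S" "K \<subseteq> set sc" "(ys, \<beta>) \<in> set (entries \<rho> sc n \<phi>)"
  shows "K \<subseteq> set ys"
  using assms
proof (induction \<phi> arbitrary: \<rho> sc n)
  case (DDep xs \<alpha>)
  then have "S \<subseteq> set xs" "K \<subseteq> \<rho> ` S" and ys: "ys = map \<rho> xs" by auto
  then have "K \<subseteq> \<rho> ` set xs" by (meson image_mono order_trans)
  then show ?case by (simp add: ys)
next
  case (DOr \<phi> \<psi>)
  from DOr.prems(4) consider "(ys, \<beta>) \<in> set (entries \<rho> sc n \<phi>)" |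
    "(ys, \<beta>) \<in> set (entries \<rho> sc (n + width \<phi>) \<psi>)" by auto
  then show ?case
  proof cases
    case 1
    show ?thesis by (rule DOr.IH(1)[OF _ _ _ 1]) (use DOr.prems in auto)
  next
    case 2
    show ?thesis by (rule DOr.IH(2)[OF _ _ _ 2]) (use DOr.prems in auto)
  qed
next
  case (DAnd \<phi> \<psi>)
  from DAnd.prems(4) consider "(ys, \<beta>) \<in> set (entries \<rho> sc n \<phi>)" |
    "(ys, \<beta>) \<in> set (entries \<rho> sc (n + width \<phi>) \<psi>)" by auto
  then show ?case
  proof cases
    case 1
    show ?thesis by (rule DAnd.IH(1)[OF _ _ _ 1]) (use DAnd.prems in auto)
  next
    case 2
    show ?thesis by (rule DAnd.IH(2)[OF _ _ _ 2]) (use DAnd.prems in auto)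
  qed
next
  case (DAll x \<phi>)
  have atoms: "S \<subseteq> set xs \<and> S \<inter> D = {} \<and> x \<notin> S" if "(D, xs) \<in> dep_atoms \<phi>" for D xs
  proof -
    have "(insert x D, xs) \<in> dep_atoms (DAll x \<phi>)" using that by auto
    from bspec[OF DAll.prems(1) this] show ?thesis by auto
  qed
  \<comment> \<open>With an atom below, \<open>x\<close> is not in \<open>S\<close>, as
    \<open>S\<close> is disjoint from the variables quantified on the way to the atom; renaming
    \<open>x\<close> therefore leaves the image of \<open>S\<close> alone.\<close>
  have "K \<subseteq> (\<rho>(x := n)) ` S" if ne: "dep_atoms \<phi> \<noteq> {}"
  proof -
    from ne obtain D xs where "(D, xs) \<in> dep_atoms \<phi>" by fastforce
    then have "x \<notin> S" "dep_atoms (DAll x \<phi>) \<noteq> {}" using atoms by auto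
    then show ?thesis using DAll.prems(2) by force
  qed
  moreover have "\<forall>(D, xs)\<in>dep_atoms \<phi>. S \<subseteq> set xs \<and> S \<inter> D = {}" using atoms by blast
  moreover have "K \<subseteq> set (n # sc)" using DAll.prems(3) by auto
  moreover have "(ys, \<beta>) \<in> set (entries (\<rho>(x := n)) (n # sc) (Suc n) \<phi>)"
    using DAll.prems(4) by (simp only: entries.simps)
  ultimately show ?case by (intro DAll.IH)
next
  case (DExB \<alpha> \<phi>)
  \<comment> \<open>The new entry is a Skolem function, whose arguments are all variables in scope;
    this case rests on \<open>K \<subseteq> set sc\<close> and not on atoms.\<close>
  show ?case
  proof (cases "(ys, \<beta>) = (sc, n)")
    case False
    then show ?thesis using DExB.prems by (intro DExB.IH[of \<rho> sc "Suc n"]) auto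
  qed (use DExB.prems in auto)
qed auto

section \<open>Regions: the prenex form and its recursive clauses\<close>

text \<open>The matrix as seen from the enclosing connective: names in the interval of
  \<open>\<phi>\<close> are read from \<open>g\<close>, the functions of its entries from
  \<open>F\<close>, everything older from \<open>v\<close> and \<open>b\<close>. The prenex form
  says that some \<open>F\<close> works for all \<open>g\<close>.\<close>

definition region :: "('r, 'a) struct \<Rightarrow> (fovar \<Rightarrow> fovar) \<Rightarrow> (bvar \<Rightarrow> bvar) \<Rightarrow> fovar list \<Rightarrow> nat \<Rightarrow>
    'r bd \<Rightarrow> (bvar \<Rightarrow> (fovar \<Rightarrow> 'a) \<Rightarrow> bool) \<Rightarrow> (fovar \<Rightarrow> 'a) \<Rightarrow> (bvar \<Rightarrow> bool) \<Rightarrow> (fovar \<Rightarrow> 'a) \<Rightarrow> bool" where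
  "region M \<rho> \<sigma> sc n \<phi> F v b g \<longleftrightarrow>
     psat M (matrix \<rho> \<sigma> sc n \<phi>) (override_on v g {n..<n + width \<phi>})
       (bext (entries \<rho> sc n \<phi>) F (override_on v g {n..<n + width \<phi>}) b)"

lemma tup_append: "tup (E @ E') \<beta> = tup E \<beta> \<union> tup E' \<beta>"
  by (auto simp: tup_def)

lemma tup_empty: "\<beta> \<notin> snd ` set E \<Longrightarrow> tup E \<beta> = {}"
  by (force simp: tup_def)

text \<open>A matrix reads only older names, its own interval and its own entries. Hence the
  valuation of a larger block, or of both sides of a binary connective, can be cut down to one
  region.\<close>

lemma region_eqI:
  assumes w: "\<And>x. x \<in> range \<rho> \<union> set sc \<union> {n..<n + width \<phi>} \<Longrightarrow>
      w x = override_on v g {n..<n + width \<phi>} x"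
    and \<sigma>: "\<And>\<beta>. \<beta> \<in> range \<sigma> \<Longrightarrow> c \<beta> = b \<beta>"
    and c: "\<And>\<beta>. \<beta> \<in> snd ` set (entries \<rho> sc n \<phi>) \<Longrightarrow>
      c \<beta> = F \<beta> (restrict w (tup (entries \<rho> sc n \<phi>) \<beta>))"
  shows "psat M (matrix \<rho> \<sigma> sc n \<phi>) w c \<longleftrightarrow> region M \<rho> \<sigma> sc n \<phi> F v b g"
  unfolding region_def
proof (rule psat_cong)
  fix x assume "x \<in> poc_free_fo (matrix \<rho> \<sigma> sc n \<phi>)"
  then show "w x = override_on v g {n..<n + width \<phi>} x"
    using poc_free_fo_matrix[of \<rho> \<sigma> sc n \<phi>] by (intro w) blast
next
  fix \<beta> assume "\<beta> \<in> poc_free_bool (matrix \<rho> \<sigma> sc n \<phi>)"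
  then consider "\<beta> \<in> snd ` set (entries \<rho> sc n \<phi>)" |
    "\<beta> \<in> range \<sigma>" "\<beta> \<notin> snd ` set (entries \<rho> sc n \<phi>)"
    using poc_free_bool_matrix[of \<rho> \<sigma> sc n \<phi>] by blast
  then show "c \<beta> = bext (entries \<rho> sc n \<phi>) F (override_on v g {n..<n + width \<phi>}) b \<beta>"
  proof cases
    case 1
    have "restrict w (tup (entries \<rho> sc n \<phi>) \<beta>) =
        restrict (override_on v g {n..<n + width \<phi>}) (tup (entries \<rho> sc n \<phi>) \<beta>)"
      by (rule restrict_ext, rule w) (use tup_entries in blast)
    then show ?thesis using 1 c[OF 1] by (simp add: bext_def)
  next
    case 2
    then show ?thesis using \<sigma>[OF 2(1)] by (simp add: bext_def)
  qed
qed

text \<open>The source of all splicing: adjacent regions look at disjoint parts of \<open>g\<close>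
  and of \<open>F\<close>.\<close>

lemma region_cong:
  assumes "\<And>x. x \<in> {n..<n + width \<phi>} \<Longrightarrow> g x = g' x"
    and "\<And>\<beta>. \<beta> \<in> {n..<n + width \<phi>} \<Longrightarrow> F \<beta> = F' \<beta>"
  shows "region M \<rho> \<sigma> sc n \<phi> F v b g \<longleftrightarrow> region M \<rho> \<sigma> sc n \<phi> F' v b g'"
proof -
  have "override_on v g {n..<n + width \<phi>} = override_on v g' {n..<n + width \<phi>}"
    using assms(1) by (auto simp: override_on_def)
  moreover have "bext (entries \<rho> sc n \<phi>) F w b = bext (entries \<rho> sc n \<phi>) F' w b" for w
    using assms(2) entries_bvars[of \<rho> sc n \<phi>] by (auto simp: bext_def fun_eq_iff)
  ultimately show ?thesis by (simp add: region_def)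
qed

lemma tup_block:
  assumes "\<beta> \<noteq> n"
  shows "tup (block n k E) \<beta> = {x \<in> tup E \<beta>. n < x}"
  using assms by (fastforce simp: tup_def block_def)

lemma block_fovars:
  assumes "\<forall>y. \<rho> y \<le> n" "set sc \<subseteq> {..n}"
  shows "set (concat (map fst (block n (width \<phi>) (entries \<rho> sc (Suc n) \<phi>)))) = {Suc n..<Suc n + width \<phi>}"
proof -
  have "x \<in> {Suc n..<Suc n + width \<phi>}"
    if "(xs, \<beta>) \<in> set (entries \<rho> sc (Suc n) \<phi>)" "x \<in> set xs" "n < x" for xs \<beta> x
  proof -
    have "x \<notin> range \<rho>" "x \<notin> set sc" using assms \<open>n < x\<close> by (auto simp: leD)
    then show ?thesis using entries_fovars[OF that(1)] that(2) by blast
  qed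
  then show ?thesis by (auto simp: block_def)
qed

text \<open>Removing the parameters from the tuples loses nothing: they are fixed when the
  connective is evaluated, so their values can be built into the functions. The dummy Boolean
  variable \<open>n\<close> clashes with nothing, lying strictly between the range of
  \<open>\<sigma>\<close> and the names of the entries.\<close>

lemma psat_block:
  assumes \<rho>: "\<forall>y. \<rho> y \<le> n" and sc: "set sc \<subseteq> {..n}" and \<sigma>: "\<forall>y. \<sigma> y < n"
  shows "psat M (PPoc (block n (width \<phi>) (entries \<rho> sc (Suc n) \<phi>)) (matrix \<rho> \<sigma> sc (Suc n) \<phi>)) v b \<longleftrightarrow>
    (\<exists>F. \<forall>g. range g \<subseteq> univ M \<longrightarrow> region M \<rho> \<sigma> sc (Suc n) \<phi> F v b g)"
proof -
  define E where "E = entries \<rho> sc (Suc n) \<phi>"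
  define B where "B = block n (width \<phi>) E"
  define w where "w g = override_on v g {Suc n..<Suc n + width \<phi>}" for g
  have V: "set (concat (map fst B)) = {Suc n..<Suc n + width \<phi>}"
    unfolding B_def E_def by (rule block_fovars[OF \<rho> sc])
  have bvars: "snd ` set B = insert n (snd ` set E)" by (simp add: B_def block_bvars)
  have E_gt: "\<beta> > n" if "\<beta> \<in> snd ` set E" for \<beta>
    using entries_bvars_bounds that unfolding E_def by fastforce
  have eq: "psat M (matrix \<rho> \<sigma> sc (Suc n) \<phi>) (w g) (bext B F (w g) b) \<longleftrightarrow>
      region M \<rho> \<sigma> sc (Suc n) \<phi> F' v b g"
    if "\<And>\<beta>. \<beta> \<in> snd ` set E \<Longrightarrow>
      F \<beta> (restrict (w g) (tup B \<beta>)) = F' \<beta> (restrict (w g) (tup E \<beta>))" for g F F'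
  proof (rule region_eqI)
    fix \<beta> assume \<beta>: "\<beta> \<in> snd ` set (entries \<rho> sc (Suc n) \<phi>)"
    then show "bext B F (w g) b \<beta> = F' \<beta> (restrict (w g) (tup (entries \<rho> sc (Suc n) \<phi>) \<beta>))"
      using that[of \<beta>] bvars by (simp add: bext_def flip: E_def)
  next
    fix \<beta> assume "\<beta> \<in> range \<sigma>"
    then have "\<beta> < n" using \<sigma> by blast
    then have "\<beta> \<notin> snd ` set B" using E_gt[of \<beta>] bvars by auto
    then show "bext B F (w g) b \<beta> = b \<beta>" by (simp add: bext_def)
  qed (simp_all add: w_def)
  have tup_B: "tup B \<beta> = {x \<in> tup E \<beta>. n < x}" if "\<beta> \<in> snd ` set E" for \<beta>
    unfolding B_def by (rule tup_block) (use E_gt[OF that] in simp)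
  have "(\<exists>F. \<forall>g. range g \<subseteq> univ M \<longrightarrow> psat M (matrix \<rho> \<sigma> sc (Suc n) \<phi>) (w g) (bext B F (w g) b)) \<longleftrightarrow>
      (\<exists>F. \<forall>g. range g \<subseteq> univ M \<longrightarrow> region M \<rho> \<sigma> sc (Suc n) \<phi> F v b g)"
  proof (intro iffI; elim exE)
    fix F assume *: "\<forall>g. range g \<subseteq> univ M \<longrightarrow>
      psat M (matrix \<rho> \<sigma> sc (Suc n) \<phi>) (w g) (bext B F (w g) b)"
    define F' where "F' \<beta> u = F \<beta> (restrict u (tup B \<beta>))" for \<beta> u
    have "F' \<beta> (restrict (w g) (tup E \<beta>)) = F \<beta> (restrict (w g) (tup B \<beta>))"
      if "\<beta> \<in> snd ` set E" for \<beta> g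
    proof -
      have "restrict (restrict (w g) (tup E \<beta>)) (tup B \<beta>) = restrict (w g) (tup B \<beta>)"
        by (rule restrict_ext) (simp add: tup_B[OF that])
      then show ?thesis by (simp add: F'_def)
    qed
    then have "region M \<rho> \<sigma> sc (Suc n) \<phi> F' v b g" if "range g \<subseteq> univ M" for g
      using * eq[of F g F'] that by simp
    then show "\<exists>F. \<forall>g. range g \<subseteq> univ M \<longrightarrow> region M \<rho> \<sigma> sc (Suc n) \<phi> F v b g" by blast
  next
    fix F assume *: "\<forall>g. range g \<subseteq> univ M \<longrightarrow> region M \<rho> \<sigma> sc (Suc n) \<phi> F v b g"
    \<comment> \<open>Arguments that were filtered out are filled in from the fixed
      \<open>v\<close>.\<close>
    define F' where "F' \<beta> u = F \<beta> (restrict (\<lambda>x. if n < x then u x else v x) (tup E \<beta>))" for \<beta> u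
    have "F' \<beta> (restrict (w g) (tup B \<beta>)) = F \<beta> (restrict (w g) (tup E \<beta>))"
      if "\<beta> \<in> snd ` set E" for \<beta> g
    proof -
      have "restrict (\<lambda>x. if n < x then restrict (w g) (tup B \<beta>) x else v x) (tup E \<beta>) =
          restrict (w g) (tup E \<beta>)"
        by (rule restrict_ext) (auto simp: tup_B[OF that] w_def)
      then show ?thesis by (simp add: F'_def)
    qed
    then have "psat M (matrix \<rho> \<sigma> sc (Suc n) \<phi>) (w g) (bext B F' (w g) b)"
      if "range g \<subseteq> univ M" for g
      using * eq[of F' g F] that by simp
    then show "\<exists>F. \<forall>g. range g \<subseteq> univ M \<longrightarrow>
      psat M (matrix \<rho> \<sigma> sc (Suc n) \<phi>) (w g) (bext B F (w g) b)" by blast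
  qed
  then show ?thesis unfolding psat.simps E_def[symmetric] B_def[symmetric] V w_def[symmetric] .
qed

lemma psat_PPoc_cong:
  assumes "\<And>x. x \<notin> set (concat (map fst ts)) \<Longrightarrow> v x = v' x"
  shows "psat M (PPoc ts \<phi>) v b \<longleftrightarrow> psat M (PPoc ts \<phi>) v' b"
proof -
  have "override_on v g (set (concat (map fst ts))) = override_on v' g (set (concat (map fst ts)))" for g
    using assms by (auto simp: override_on_def fun_eq_iff)
  then show ?thesis unfolding psat.simps by presburger
qed

text \<open>The outer \<open>F\<close> and \<open>g\<close> disappear: the name \<open>n\<close> is
  overwritten by \<open>a\<close>, and the rest of the interval is bound again by the inner
  connective. The inner functions are thus chosen after \<open>v\<close>, \<open>b\<close> and
  \<open>a\<close>.\<close>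

lemma region_DEx:
  assumes \<rho>: "\<forall>y. \<rho> y < n" and \<sigma>: "\<forall>y. \<sigma> y < n" and sc: "set sc \<subseteq> {..<n}"
  shows "region M \<rho> \<sigma> sc n (DEx x \<phi>) F v b g \<longleftrightarrow>
    (\<exists>a\<in>univ M. \<exists>F. \<forall>g. range g \<subseteq> univ M \<longrightarrow>
       region M (\<rho>(x := n)) \<sigma> (n # sc) (Suc n) \<phi> F (v(n := a)) b g)"
proof -
  let ?\<rho> = "\<rho>(x := n)"
  let ?B = "block n (width \<phi>) (entries ?\<rho> (n # sc) (Suc n) \<phi>)"
  have \<rho>': "\<forall>y. ?\<rho> y \<le> n" using \<rho> by (simp add: less_imp_le)
  have sc': "set (n # sc) \<subseteq> {..n}" using sc by auto
  have V: "set (concat (map fst ?B)) = {Suc n..<Suc n + width \<phi>}" by (rule block_fovars[OF \<rho>' sc'])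
  have "psat M (PPoc ?B (matrix ?\<rho> \<sigma> (n # sc) (Suc n) \<phi>))
        ((override_on v g {n..<n + width (DEx x \<phi>)})(n := a)) b \<longleftrightarrow>
      psat M (PPoc ?B (matrix ?\<rho> \<sigma> (n # sc) (Suc n) \<phi>)) (v(n := a)) b" for a
    by (rule psat_PPoc_cong, unfold V) (auto simp: override_on_def)
  moreover have "bext (entries \<rho> sc n (DEx x \<phi>)) F w b = b" for w by (simp add: bext_def)
  ultimately show ?thesis
    unfolding region_def[of M \<rho>] matrix.simps psat.simps(10)
    by (simp only: psat_block[OF \<rho>' sc' \<sigma>])
qed

text \<open>The scope lies below \<open>n\<close>, out of reach of \<open>g\<close>, so the Skolem
  value is already determined by \<open>v\<close> and can be stored in \<open>b\<close>.\<close>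

lemma region_DExB:
  assumes \<rho>: "\<forall>y. \<rho> y < n" and \<sigma>: "\<forall>y. \<sigma> y < n" and sc: "set sc \<subseteq> {..<n}"
  shows "region M \<rho> \<sigma> sc n (DExB \<alpha> \<phi>) F v b g \<longleftrightarrow>
    region M \<rho> (\<sigma>(\<alpha> := n)) sc (Suc n) \<phi> F v (b(n := F n (restrict v (set sc)))) g"
proof -
  define E where "E = entries \<rho> sc (Suc n) \<phi>"
  define w where "w = override_on v g {n..<n + width (DExB \<alpha> \<phi>)}"
  have E_gt: "\<beta> > n" if "\<beta> \<in> snd ` set E" for \<beta>
    using entries_bvars_bounds that unfolding E_def by fastforce
  have tup_n: "tup ((sc, n) # E) n = set sc"
    using E_gt tup_append[of "[(sc, n)]" E n] tup_empty[of n E] by (auto simp: tup_def)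
  have tup_E: "tup ((sc, n) # E) \<beta> = tup E \<beta>" if "\<beta> \<noteq> n" for \<beta> using that by (auto simp: tup_def)
  have w_sc: "restrict w (set sc) = restrict v (set sc)"
    by (rule restrict_ext) (use sc in \<open>auto simp: w_def override_on_def\<close>)
  have "psat M (matrix \<rho> (\<sigma>(\<alpha> := n)) sc (Suc n) \<phi>) w (bext ((sc, n) # E) F w b) \<longleftrightarrow>
      region M \<rho> (\<sigma>(\<alpha> := n)) sc (Suc n) \<phi> F v (b(n := F n (restrict v (set sc)))) g"
  proof (rule region_eqI)
    fix x assume x: "x \<in> range \<rho> \<union> set sc \<union> {Suc n..<Suc n + width \<phi>}"
    then have "x \<noteq> n" using \<rho> sc by (auto simp: less_le)
    then show "w x = override_on v g {Suc n..<Suc n + width \<phi>} x"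
      by (auto simp: w_def override_on_def)
  next
    fix \<beta> assume "\<beta> \<in> range (\<sigma>(\<alpha> := n))"
    then have "\<beta> = n \<or> \<beta> < n" using \<sigma> by (auto split: if_splits)
    then show "bext ((sc, n) # E) F w b \<beta> = (b(n := F n (restrict v (set sc)))) \<beta>"
    proof
      assume "\<beta> < n"
      then have "\<beta> \<notin> snd ` set E" using E_gt[of \<beta>] by auto
      then show ?thesis using \<open>\<beta> < n\<close> by (simp add: bext_def)
    qed (simp add: bext_def tup_n w_sc)
  next
    fix \<beta> assume "\<beta> \<in> snd ` set (entries \<rho> sc (Suc n) \<phi>)"
    then show "bext ((sc, n) # E) F w b \<beta> = F \<beta> (restrict w (tup (entries \<rho> sc (Suc n) \<phi>) \<beta>))"
      using E_gt[of \<beta>] by (auto simp: bext_def tup_E simp flip: E_def)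
  qed
  then show ?thesis by (simp add: region_def[of M \<rho> \<sigma>] w_def E_def)
qed

lemma region_DAll:
  "region M \<rho> \<sigma> sc n (DAll x \<phi>) F v b g \<longleftrightarrow>
    region M (\<rho>(x := n)) \<sigma> (n # sc) (Suc n) \<phi> F (v(n := g n)) b g"
proof -
  have "override_on v g {n..<n + width (DAll x \<phi>)} =
      override_on (v(n := g n)) g {Suc n..<Suc n + width \<phi>}"
    by (auto simp: override_on_def fun_eq_iff)
  then show ?thesis by (simp only: region_def matrix.simps entries.simps)
qed

text \<open>As the two sides have disjoint intervals, each behaves under the joint valuation and the
  joint entries as if it were alone.\<close>

lemma psat_matrix_append:
  fixes \<phi> \<psi> :: "'r bd" and v g :: "fovar \<Rightarrow> 'a" and b :: "bvar \<Rightarrow> bool"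
    and F :: "bvar \<Rightarrow> (fovar \<Rightarrow> 'a) \<Rightarrow> bool"
  assumes \<rho>: "\<forall>y. \<rho> y < n" and \<sigma>: "\<forall>y. \<sigma> y < n" and sc: "set sc \<subseteq> {..<n}"
  defines "w \<equiv> override_on v g {n..<n + (width \<phi> + width \<psi>)}"
  defines "c \<equiv> bext (entries \<rho> sc n \<phi> @ entries \<rho> sc (n + width \<phi>) \<psi>) F w b"
  shows "psat M (matrix \<rho> \<sigma> sc n \<phi>) w c \<longleftrightarrow> region M \<rho> \<sigma> sc n \<phi> F v b g"
    and "psat M (matrix \<rho> \<sigma> sc (n + width \<phi>) \<psi>) w c \<longleftrightarrow> region M \<rho> \<sigma> sc (n + width \<phi>) \<psi> F v b g"
proof -
  define E where "E = entries \<rho> sc n \<phi>"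
  define E' where "E' = entries \<rho> sc (n + width \<phi>) \<psi>"
  have E: "n \<le> \<beta> \<and> \<beta> < n + width \<phi>" if "\<beta> \<in> snd ` set E" for \<beta>
    using entries_bvars_bounds that unfolding E_def by fastforce
  have E': "n + width \<phi> \<le> \<beta>" if "\<beta> \<in> snd ` set E'" for \<beta>
    using entries_bvars_bounds that unfolding E'_def by fastforce
  have c: "c = bext (E @ E') F w b" by (simp add: c_def E_def E'_def)
  have c_\<sigma>: "c \<beta> = b \<beta>" if "\<beta> \<in> range \<sigma>" for \<beta>
  proof -
    have "\<beta> < n" using that \<sigma> by blast
    then have "\<beta> \<notin> snd ` set (E @ E')" using E[of \<beta>] E'[of \<beta>] by auto
    then show ?thesis by (simp add: c bext_def)
  qed
  have old: "x < n" if "x \<in> range \<rho> \<union> set sc" for x using that \<rho> sc by auto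
  show "psat M (matrix \<rho> \<sigma> sc n \<phi>) w c \<longleftrightarrow> region M \<rho> \<sigma> sc n \<phi> F v b g"
  proof (rule region_eqI)
    fix x assume "x \<in> range \<rho> \<union> set sc \<union> {n..<n + width \<phi>}"
    then have "x < n \<or> x \<in> {n..<n + width \<phi>}" using old by blast
    then show "w x = override_on v g {n..<n + width \<phi>} x" by (auto simp: w_def override_on_def)
  next
    fix \<beta> assume "\<beta> \<in> snd ` set (entries \<rho> sc n \<phi>)"
    then have \<beta>: "\<beta> \<in> snd ` set E" by (simp add: E_def)
    then have "\<beta> \<notin> snd ` set E'" using E[of \<beta>] E'[of \<beta>] by auto
    then have "tup (E @ E') \<beta> = tup E \<beta>" by (simp add: tup_append tup_empty)
    with \<beta> show "c \<beta> = F \<beta> (restrict w (tup (entries \<rho> sc n \<phi>) \<beta>))"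
      by (auto simp: c bext_def simp flip: E_def)
  qed (rule c_\<sigma>)
  show "psat M (matrix \<rho> \<sigma> sc (n + width \<phi>) \<psi>) w c \<longleftrightarrow> region M \<rho> \<sigma> sc (n + width \<phi>) \<psi> F v b g"
  proof (rule region_eqI)
    fix x assume "x \<in> range \<rho> \<union> set sc \<union> {n + width \<phi>..<n + width \<phi> + width \<psi>}"
    then have "x < n \<or> x \<in> {n + width \<phi>..<n + width \<phi> + width \<psi>}" using old by blast
    then show "w x = override_on v g {n + width \<phi>..<n + width \<phi> + width \<psi>} x"
      by (auto simp: w_def override_on_def)
  next
    fix \<beta> assume "\<beta> \<in> snd ` set (entries \<rho> sc (n + width \<phi>) \<psi>)"
    then have \<beta>: "\<beta> \<in> snd ` set E'" by (simp add: E'_def)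
    then have "\<beta> \<notin> snd ` set E" using E[of \<beta>] E'[of \<beta>] by auto
    then have "tup (E @ E') \<beta> = tup E' \<beta>" by (simp add: tup_append tup_empty)
    with \<beta> show "c \<beta> = F \<beta> (restrict w (tup (entries \<rho> sc (n + width \<phi>) \<psi>) \<beta>))"
      by (auto simp: c bext_def simp flip: E'_def)
  qed (rule c_\<sigma>)
qed

lemma region_DOr:
  assumes "\<forall>y. \<rho> y < n" "\<forall>y. \<sigma> y < n" "set sc \<subseteq> {..<n}"
  shows "region M \<rho> \<sigma> sc n (DOr \<phi> \<psi>) F v b g \<longleftrightarrow>
    region M \<rho> \<sigma> sc n \<phi> F v b g \<or> region M \<rho> \<sigma> sc (n + width \<phi>) \<psi> F v b g"
  unfolding region_def[of M \<rho> \<sigma> sc n "DOr \<phi> \<psi>"] matrix.simps entries.simps width.simps psat.simps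
  by (simp only: psat_matrix_append[OF assms])

lemma region_DAnd:
  assumes "\<forall>y. \<rho> y < n" "\<forall>y. \<sigma> y < n" "set sc \<subseteq> {..<n}"
  shows "region M \<rho> \<sigma> sc n (DAnd \<phi> \<psi>) F v b g \<longleftrightarrow>
    region M \<rho> \<sigma> sc n \<phi> F v b g \<and> region M \<rho> \<sigma> sc (n + width \<phi>) \<psi> F v b g"
  unfolding region_def[of M \<rho> \<sigma> sc n "DAnd \<phi> \<psi>"] matrix.simps entries.simps width.simps psat.simps
  by (simp only: psat_matrix_append[OF assms])

section \<open>Moving functions and quantifiers outward\<close>

text \<open>Splicing \<open>g\<close> below \<open>m\<close> with \<open>g'\<close> from
  \<open>m\<close> on turns one common valuation into two independent ones, and a universal
  quantifier over independent variables distributes over a disjunction. Conversely, \<open>F\<close>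
  and \<open>F'\<close> are spliced at the same place.\<close>

lemma ex_regions_disj:
  assumes "m = n + width \<phi>"
  shows "(\<exists>F. \<forall>p\<in>X. \<forall>g. range g \<subseteq> A \<longrightarrow> region M \<rho> \<sigma> sc n \<phi> F (fst p) (snd p) g \<or>
      region M \<rho> \<sigma> sc m \<psi> F (fst p) (snd p) g) \<longleftrightarrow>
    (\<exists>F F'. \<forall>p\<in>X. (\<forall>g. range g \<subseteq> A \<longrightarrow> region M \<rho> \<sigma> sc n \<phi> F (fst p) (snd p) g) \<or>
      (\<forall>g. range g \<subseteq> A \<longrightarrow> region M \<rho> \<sigma> sc m \<psi> F' (fst p) (snd p) g))" (is "?L \<longleftrightarrow> ?R")
proof
  assume ?L
  then obtain F where F: "\<And>p g. p \<in> X \<Longrightarrow> range g \<subseteq> A \<Longrightarrow>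
    region M \<rho> \<sigma> sc n \<phi> F (fst p) (snd p) g \<or> region M \<rho> \<sigma> sc m \<psi> F (fst p) (snd p) g" by blast
  have "region M \<rho> \<sigma> sc n \<phi> F (fst p) (snd p) g \<or> region M \<rho> \<sigma> sc m \<psi> F (fst p) (snd p) g'"
    if "p \<in> X" "range g \<subseteq> A" "range g' \<subseteq> A" for p g g'
  proof -
    let ?g = "\<lambda>x. if x < m then g x else g' x"
    have "range ?g \<subseteq> A" using that(2,3) by auto
    moreover have "region M \<rho> \<sigma> sc n \<phi> F (fst p) (snd p) ?g \<longleftrightarrow> region M \<rho> \<sigma> sc n \<phi> F (fst p) (snd p) g"
      by (rule region_cong) (simp_all add: assms)
    moreover have "region M \<rho> \<sigma> sc m \<psi> F (fst p) (snd p) ?g \<longleftrightarrow> region M \<rho> \<sigma> sc m \<psi> F (fst p) (snd p) g'"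
      by (rule region_cong) (simp_all add: assms)
    ultimately show ?thesis using F[OF that(1), of ?g] by simp
  qed
  then show ?R by (intro exI[of _ F] ballI) blast
next
  assume ?R
  then obtain F F' where F: "\<And>p. p \<in> X \<Longrightarrow>
    (\<forall>g. range g \<subseteq> A \<longrightarrow> region M \<rho> \<sigma> sc n \<phi> F (fst p) (snd p) g) \<or>
    (\<forall>g. range g \<subseteq> A \<longrightarrow> region M \<rho> \<sigma> sc m \<psi> F' (fst p) (snd p) g)" by blast
  let ?F = "\<lambda>\<beta>. if \<beta> < m then F \<beta> else F' \<beta>"
  have 1: "region M \<rho> \<sigma> sc n \<phi> ?F (fst p) (snd p) g \<longleftrightarrow> region M \<rho> \<sigma> sc n \<phi> F (fst p) (snd p) g" for p g
    by (rule region_cong) (simp_all add: assms)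
  have 2: "region M \<rho> \<sigma> sc m \<psi> ?F (fst p) (snd p) g \<longleftrightarrow> region M \<rho> \<sigma> sc m \<psi> F' (fst p) (snd p) g" for p g
    by (rule region_cong) (simp_all add: assms)
  have "\<forall>p\<in>X. \<forall>g. range g \<subseteq> A \<longrightarrow> region M \<rho> \<sigma> sc n \<phi> ?F (fst p) (snd p) g \<or>
      region M \<rho> \<sigma> sc m \<psi> ?F (fst p) (snd p) g" unfolding 1 2 using F by blast
  then show ?L by (intro exI[of _ ?F])
qed

lemma ex_regions_conj:
  assumes "m = n + width \<phi>"
  shows "(\<exists>F. \<forall>p\<in>X. \<forall>g. range g \<subseteq> A \<longrightarrow> region M \<rho> \<sigma> sc n \<phi> F (fst p) (snd p) g \<and>
      region M \<rho> \<sigma> sc m \<psi> F (fst p) (snd p) g) \<longleftrightarrow>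
    (\<exists>F. \<forall>p\<in>X. \<forall>g. range g \<subseteq> A \<longrightarrow> region M \<rho> \<sigma> sc n \<phi> F (fst p) (snd p) g) \<and>
    (\<exists>F. \<forall>p\<in>X. \<forall>g. range g \<subseteq> A \<longrightarrow> region M \<rho> \<sigma> sc m \<psi> F (fst p) (snd p) g)" (is "?L \<longleftrightarrow> ?R")
proof
  assume ?R
  then obtain F F' where F: "\<forall>p\<in>X. \<forall>g. range g \<subseteq> A \<longrightarrow> region M \<rho> \<sigma> sc n \<phi> F (fst p) (snd p) g"
    "\<forall>p\<in>X. \<forall>g. range g \<subseteq> A \<longrightarrow> region M \<rho> \<sigma> sc m \<psi> F' (fst p) (snd p) g" by blast
  let ?F = "\<lambda>\<beta>. if \<beta> < m then F \<beta> else F' \<beta>"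
  have 1: "region M \<rho> \<sigma> sc n \<phi> ?F (fst p) (snd p) g \<longleftrightarrow> region M \<rho> \<sigma> sc n \<phi> F (fst p) (snd p) g" for p g
    by (rule region_cong) (simp_all add: assms)
  have 2: "region M \<rho> \<sigma> sc m \<psi> ?F (fst p) (snd p) g \<longleftrightarrow> region M \<rho> \<sigma> sc m \<psi> F' (fst p) (snd p) g" for p g
    by (rule region_cong) (simp_all add: assms)
  have "\<forall>p\<in>X. \<forall>g. range g \<subseteq> A \<longrightarrow> region M \<rho> \<sigma> sc n \<phi> ?F (fst p) (snd p) g \<and>
      region M \<rho> \<sigma> sc m \<psi> ?F (fst p) (snd p) g" unfolding 1 2 using F by blast
  then show ?L by (intro exI[of _ ?F])
qed blast

text \<open>If the arguments of an entry missed part of the scope, functions chosen separately at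
  two members could conflict. \<open>cover\<close>, which is what boundedness leaves after renaming,
  rules this out.\<close>

lemma choose_existential:
  fixes M :: "('r, 'a) struct"
  assumes sep: "separates (set sc) X"
    and sc: "\<And>x. x \<in> set sc \<Longrightarrow> x < n"
    and cover: "\<And>\<beta>. \<beta> \<in> snd ` set (entries \<rho> (n # sc) (Suc n) \<phi>) \<Longrightarrow>
      set sc \<subseteq> tup (entries \<rho> (n # sc) (Suc n) \<phi>) \<beta>"
  shows "(\<exists>H. (\<forall>p\<in>X. H p \<in> univ M) \<and> (\<exists>F. \<forall>p\<in>X. \<forall>g. range g \<subseteq> univ M \<longrightarrow>
      region M \<rho> \<sigma> (n # sc) (Suc n) \<phi> F ((fst p)(n := H p)) (snd p) g)) \<longleftrightarrow>
    (\<forall>p\<in>X. \<exists>a\<in>univ M. \<exists>F. \<forall>g. range g \<subseteq> univ M \<longrightarrow>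
      region M \<rho> \<sigma> (n # sc) (Suc n) \<phi> F ((fst p)(n := a)) (snd p) g)" (is "?L \<longleftrightarrow> ?R")
proof
  assume ?R
  then have "\<forall>p\<in>X. \<exists>a F. a \<in> univ M \<and> (\<forall>g. range g \<subseteq> univ M \<longrightarrow>
      region M \<rho> \<sigma> (n # sc) (Suc n) \<phi> F ((fst p)(n := a)) (snd p) g)" by blast
  then obtain H F where H: "\<And>p. p \<in> X \<Longrightarrow> H p \<in> univ M" and F: "\<And>p g. \<lbrakk>p \<in> X; range g \<subseteq> univ M\<rbrakk> \<Longrightarrow>
      region M \<rho> \<sigma> (n # sc) (Suc n) \<phi> (F p) ((fst p)(n := H p)) (snd p) g"
    unfolding bchoice_iff by blast
  define orig where "orig v = (THE p. p \<in> X \<and> (\<forall>x\<in>set sc. fst p x = v x))" for v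
  \<comment> \<open>The argument \<open>u\<close> contains the values of all of \<open>sc\<close>;
    \<open>orig\<close> recovers from them the member, and so the function that was chosen for
    it.\<close>
  define F' where "F' \<beta> u = F (orig u) \<beta> u" for \<beta> u
  have "region M \<rho> \<sigma> (n # sc) (Suc n) \<phi> F' ((fst p)(n := H p)) (snd p) g"
    if p: "p \<in> X" and g: "range g \<subseteq> univ M" for p g
  proof -
    define E where "E = entries \<rho> (n # sc) (Suc n) \<phi>"
    define w where "w = override_on ((fst p)(n := H p)) g {Suc n..<Suc n + width \<phi>}"
    have w_sc: "w x = fst p x" if "x \<in> set sc" for x
      using sc[OF that] by (simp add: w_def)
    have "F' \<beta> (restrict w (tup E \<beta>)) = F p \<beta> (restrict w (tup E \<beta>))" if "\<beta> \<in> snd ` set E" for \<beta>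
    proof -
      have *: "restrict w (tup E \<beta>) x = fst p x" if "x \<in> set sc" for x
        using w_sc[OF that] cover \<open>\<beta> \<in> snd ` set E\<close> that unfolding E_def by auto
      have "orig (restrict w (tup E \<beta>)) = p"
        unfolding orig_def
      proof (rule the_equality)
        show "p \<in> X \<and> (\<forall>x\<in>set sc. fst p x = restrict w (tup E \<beta>) x)" using p * by metis
        fix q assume "q \<in> X \<and> (\<forall>x\<in>set sc. fst q x = restrict w (tup E \<beta>) x)"
        then have "q \<in> X" "\<forall>x\<in>set sc. fst q x = fst p x" using * by auto
        then show "q = p" using sep p unfolding separates_def by blast
      qed
      then show ?thesis by (simp add: F'_def)
    qed
    then have "bext E F' w (snd p) = bext E (F p) w (snd p)" by (auto simp: bext_def)
    then show ?thesis
      using F[OF p g] by (simp only: region_def E_def[symmetric] w_def[symmetric])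
  qed
  then show ?L using H by blast
qed blast

text \<open>The team stays arbitrary because disjunction splits it and quantifiers extend it. The
  equation for \<open>\<Gamma>\<close> is conditional: when a name in scope is quantified again,
  \<open>\<rho>\<close> knows only its newest copy. The equation serves only at \<open>DEx\<close>
  with atoms below, where boundedness makes \<open>\<Gamma>\<close> distinct.\<close>

lemma matrix_correct:
  fixes M :: "('r, 'a) struct"
  assumes ne: "univ M \<noteq> {}" and "bounded \<Gamma> \<phi>" "distinct \<Gamma> \<longrightarrow> map \<rho> \<Gamma> = sc"
    "\<forall>y. \<rho> y < n" "\<forall>y. \<sigma> y < n" "set sc \<subseteq> {..<n}" "separates (set sc) X"
  shows "(\<exists>f. \<forall>p\<in>X. fsat M \<phi> f (fst p \<circ> \<rho>) (snd p \<circ> \<sigma>)) \<longleftrightarrow>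
    (\<exists>F. \<forall>p\<in>X. \<forall>g. range g \<subseteq> univ M \<longrightarrow> region M \<rho> \<sigma> sc n \<phi> F (fst p) (snd p) g)"
  using assms(2-)
proof (induction \<phi> arbitrary: \<Gamma> \<rho> \<sigma> sc n X)
  case (DDep xs \<alpha>)
  have "region M \<rho> \<sigma> sc n (DDep xs \<alpha>) F v b g \<longleftrightarrow> b (\<sigma> \<alpha>) = F n (restrict v (\<rho> ` set xs))" for F v b g
  proof -
    have "tup [(map \<rho> xs, n)] n = \<rho> ` set xs" by (auto simp: tup_def)
    moreover have "restrict (override_on v g {n..<n + 1}) (\<rho> ` set xs) = restrict v (\<rho> ` set xs)"
      using DDep.prems(3) by (intro restrict_ext) (auto simp: override_on_def leD)
    moreover have "\<sigma> \<alpha> \<noteq> n" using DDep.prems(4)[rule_format, of \<alpha>] by simp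
    ultimately show ?thesis by (auto simp: region_def bext_def)
  qed
  then have "(\<exists>F. \<forall>p\<in>X. \<forall>g. range g \<subseteq> univ M \<longrightarrow> region M \<rho> \<sigma> sc n (DDep xs \<alpha>) F (fst p) (snd p) g) \<longleftrightarrow>
      (\<exists>F. \<forall>p\<in>X. snd p (\<sigma> \<alpha>) = F n (restrict (fst p) (\<rho> ` set xs)))"
    by (simp add: ex_range_subset[OF ne])
  also have "\<dots> \<longleftrightarrow> (\<exists>h. \<forall>p\<in>X. snd p (\<sigma> \<alpha>) = h (restrict (fst p) (\<rho> ` set xs)))"
    by (rule ex_fun_at)
  \<comment> \<open>Going back to the relational form of dependence changes the argument from
    renamed variables to original ones without constructing a function.\<close>
  also have "\<dots> \<longleftrightarrow> (\<exists>h. \<forall>p\<in>X. snd p (\<sigma> \<alpha>) = h (restrict (fst p \<circ> \<rho>) (set xs)))"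
    unfolding dependence_function[symmetric] by simp
  also have "\<dots> \<longleftrightarrow> (\<exists>f. \<forall>p\<in>X. fsat M (DDep xs \<alpha>) f (fst p \<circ> \<rho>) (snd p \<circ> \<sigma>))"
    unfolding fsat.simps o_apply by (rule ex_fun_at[symmetric])
  finally show ?case by (rule sym)
next
  case (DOr \<phi> \<psi>)
  have IH1: "(\<exists>f. \<forall>p\<in>Y. fsat M \<phi> f (fst p \<circ> \<rho>) (snd p \<circ> \<sigma>)) \<longleftrightarrow>
    (\<exists>F. \<forall>p\<in>Y. \<forall>g. range g \<subseteq> univ M \<longrightarrow> region M \<rho> \<sigma> sc n \<phi> F (fst p) (snd p) g)" if "Y \<subseteq> X" for Y
    using DOr.prems separates_subset[OF DOr.prems(6) that] by (intro DOr.IH(1)) simp_all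
  have IH2: "(\<exists>f. \<forall>p\<in>Y. fsat M \<psi> f (fst p \<circ> \<rho>) (snd p \<circ> \<sigma>)) \<longleftrightarrow>
    (\<exists>F. \<forall>p\<in>Y. \<forall>g. range g \<subseteq> univ M \<longrightarrow> region M \<rho> \<sigma> sc (n + width \<phi>) \<psi> F (fst p) (snd p) g)"
    if "Y \<subseteq> X" for Y
    using DOr.prems separates_subset[OF DOr.prems(6) that]
    by (intro DOr.IH(2)) (auto intro: trans_less_add1)
  have "(\<exists>f. \<forall>p\<in>X. fsat M (DOr \<phi> \<psi>) f (fst p \<circ> \<rho>) (snd p \<circ> \<sigma>)) \<longleftrightarrow>
      (\<exists>f g. \<forall>p\<in>X. fsat M \<phi> f (fst p \<circ> \<rho>) (snd p \<circ> \<sigma>) \<or> fsat M \<psi> g (fst p \<circ> \<rho>) (snd p \<circ> \<sigma>))"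
    unfolding fsat.simps by (rule ex_merge_paths)
  also have "\<dots> \<longleftrightarrow> (\<exists>F F'. \<forall>p\<in>X. (\<forall>g. range g \<subseteq> univ M \<longrightarrow> region M \<rho> \<sigma> sc n \<phi> F (fst p) (snd p) g) \<or>
      (\<forall>g. range g \<subseteq> univ M \<longrightarrow> region M \<rho> \<sigma> sc (n + width \<phi>) \<psi> F' (fst p) (snd p) g))"
    unfolding ex_split_disj by (intro ex_cong1 conj_cong refl IH1 IH2) auto
  finally show ?case
    by (simp only: ex_regions_disj[OF refl] region_DOr[OF DOr.prems(3,4,5)])
next
  case (DAnd \<phi> \<psi>)
  have IH1: "(\<exists>f. \<forall>p\<in>X. fsat M \<phi> f (fst p \<circ> \<rho>) (snd p \<circ> \<sigma>)) \<longleftrightarrow>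
    (\<exists>F. \<forall>p\<in>X. \<forall>g. range g \<subseteq> univ M \<longrightarrow> region M \<rho> \<sigma> sc n \<phi> F (fst p) (snd p) g)"
    using DAnd.prems by (intro DAnd.IH(1)) simp_all
  have IH2: "(\<exists>f. \<forall>p\<in>X. fsat M \<psi> f (fst p \<circ> \<rho>) (snd p \<circ> \<sigma>)) \<longleftrightarrow>
    (\<exists>F. \<forall>p\<in>X. \<forall>g. range g \<subseteq> univ M \<longrightarrow> region M \<rho> \<sigma> sc (n + width \<phi>) \<psi> F (fst p) (snd p) g)"
    using DAnd.prems by (intro DAnd.IH(2)) (auto intro: trans_less_add1)
  have "(\<exists>f. \<forall>p\<in>X. fsat M (DAnd \<phi> \<psi>) f (fst p \<circ> \<rho>) (snd p \<circ> \<sigma>)) \<longleftrightarrow>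
      (\<exists>f g. \<forall>p\<in>X. fsat M \<phi> f (fst p \<circ> \<rho>) (snd p \<circ> \<sigma>) \<and> fsat M \<psi> g (fst p \<circ> \<rho>) (snd p \<circ> \<sigma>))"
    unfolding fsat.simps by (rule ex_merge_paths)
  also have "\<dots> \<longleftrightarrow> (\<exists>f. \<forall>p\<in>X. fsat M \<phi> f (fst p \<circ> \<rho>) (snd p \<circ> \<sigma>)) \<and>
      (\<exists>g. \<forall>p\<in>X. fsat M \<psi> g (fst p \<circ> \<rho>) (snd p \<circ> \<sigma>))" by (simp add: ball_conj_distrib)
  finally show ?case
    by (simp only: IH1 IH2 ex_regions_conj[OF refl] region_DAnd[OF DAnd.prems(3,4,5)])
next
  case (DAll x \<phi>)
  note \<rho> = DAll.prems(3)
  have fresh: "\<rho> y \<noteq> n" for y using \<rho>[rule_format, of y] by simp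
  let ?Y = "(\<lambda>(p, a). ((fst p)(n := a), snd p)) ` (X \<times> univ M)"
  have "separates (set sc \<union> {n}) ?Y"
    by (rule separates_image[OF DAll.prems(6), where \<pi> = fst])
      (use DAll.prems(5) in \<open>auto split: prod.splits\<close>)
  then have "(\<exists>f. \<forall>p\<in>?Y. fsat M \<phi> f (fst p \<circ> \<rho>(x := n)) (snd p \<circ> \<sigma>)) \<longleftrightarrow>
    (\<exists>F. \<forall>p\<in>?Y. \<forall>g. range g \<subseteq> univ M \<longrightarrow> region M (\<rho>(x := n)) \<sigma> (n # sc) (Suc n) \<phi> F (fst p) (snd p) g)"
    using DAll.prems by (intro DAll.IH[of "x # \<Gamma>"]) (auto simp: less_SucI)
  then have IH: "(\<exists>f. \<forall>p\<in>X. \<forall>a\<in>univ M. fsat M \<phi> f ((fst p \<circ> \<rho>)(x := a)) (snd p \<circ> \<sigma>)) \<longleftrightarrow>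
    (\<exists>F. \<forall>p\<in>X. \<forall>a\<in>univ M. \<forall>g. range g \<subseteq> univ M \<longrightarrow>
      region M (\<rho>(x := n)) \<sigma> (n # sc) (Suc n) \<phi> F ((fst p)(n := a)) (snd p) g)"
    by (simp add: fun_upd_comp_fresh[OF fresh])
  \<comment> \<open>The region starting at \<open>Suc n\<close> does not look at \<open>g n\<close>,
    so this place is free to carry the value of the universally quantified variable.\<close>
  have "(\<forall>a\<in>univ M. \<forall>g. range g \<subseteq> univ M \<longrightarrow>
      region M (\<rho>(x := n)) \<sigma> (n # sc) (Suc n) \<phi> F (v(n := a)) b g) \<longleftrightarrow>
    (\<forall>g. range g \<subseteq> univ M \<longrightarrow> region M (\<rho>(x := n)) \<sigma> (n # sc) (Suc n) \<phi> F (v(n := g n)) b g)"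
    (is "?L \<longleftrightarrow> ?R") for F v b
  proof
    assume ?R
    have "region M (\<rho>(x := n)) \<sigma> (n # sc) (Suc n) \<phi> F (v(n := a)) b g"
      if "a \<in> univ M" "range g \<subseteq> univ M" for a g
    proof -
      have "range (g(n := a)) \<subseteq> univ M" using that by auto
      then have "region M (\<rho>(x := n)) \<sigma> (n # sc) (Suc n) \<phi> F (v(n := (g(n := a)) n)) b (g(n := a))"
        using \<open>?R\<close> by blast
      moreover have "region M (\<rho>(x := n)) \<sigma> (n # sc) (Suc n) \<phi> F (v(n := a)) b (g(n := a)) \<longleftrightarrow>
          region M (\<rho>(x := n)) \<sigma> (n # sc) (Suc n) \<phi> F (v(n := a)) b g"
        by (rule region_cong) simp_all
      ultimately show ?thesis by simp
    qed
    then show ?L by blast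
  qed blast
  then show ?case unfolding fsat.simps region_DAll by (simp only: IH)
next
  case (DEx x \<phi>)
  note \<rho> = DEx.prems(3) and \<sigma> = DEx.prems(4) and sc = DEx.prems(5) and sep = DEx.prems(6)
  have fresh: "\<rho> y \<noteq> n" for y using \<rho>[rule_format, of y] by simp
  have IH: "(\<exists>f. \<forall>p\<in>X. fsat M \<phi> f ((fst p \<circ> \<rho>)(x := H p)) (snd p \<circ> \<sigma>)) \<longleftrightarrow>
    (\<exists>F. \<forall>p\<in>X. \<forall>g. range g \<subseteq> univ M \<longrightarrow>
      region M (\<rho>(x := n)) \<sigma> (n # sc) (Suc n) \<phi> F ((fst p)(n := H p)) (snd p) g)" for H
  proof -
    let ?Y = "(\<lambda>p. ((fst p)(n := H p), snd p)) ` X"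
    have "separates (set sc \<union> {n}) ?Y"
      by (rule separates_image[OF sep, where \<pi> = id]) (use sc in auto)
    then have "(\<exists>f. \<forall>p\<in>?Y. fsat M \<phi> f (fst p \<circ> \<rho>(x := n)) (snd p \<circ> \<sigma>)) \<longleftrightarrow>
      (\<exists>F. \<forall>p\<in>?Y. \<forall>g. range g \<subseteq> univ M \<longrightarrow>
        region M (\<rho>(x := n)) \<sigma> (n # sc) (Suc n) \<phi> F (fst p) (snd p) g)"
      using DEx.prems by (intro DEx.IH[of "x # \<Gamma>"]) (auto simp: less_SucI)
    then show ?thesis by (simp add: fun_upd_comp_fresh[OF fresh])
  qed
  have atoms: "set (x # \<Gamma>) \<subseteq> set xs \<and> distinct (x # \<Gamma>) \<and> set (x # \<Gamma>) \<inter> D = {}"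
    if "(D, xs) \<in> dep_atoms \<phi>" for D xs using DEx.prems(1) that by auto
  \<comment> \<open>An atom in \<open>\<phi>\<close> forces \<open>x # \<Gamma>\<close> to be
    distinct; then \<open>\<rho>\<close> maps \<open>\<Gamma>\<close> onto the scope, and its update
    at \<open>x\<close> does not interfere.\<close>
  have image: "set sc \<subseteq> (\<rho>(x := n)) ` set \<Gamma>" if ne_atoms: "dep_atoms \<phi> \<noteq> {}"
  proof -
    from ne_atoms obtain D xs where "(D, xs) \<in> dep_atoms \<phi>" by fastforce
    then have "x \<notin> set \<Gamma>" "distinct \<Gamma>" using atoms by auto
    then show ?thesis using DEx.prems(2) by force
  qed
  have "set sc \<subseteq> set ys" if "(ys, \<beta>) \<in> set (entries (\<rho>(x := n)) (n # sc) (Suc n) \<phi>)" for ys \<beta>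
    by (rule entries_cover[OF _ image _ that]) (use atoms in auto)
  then have cover: "set sc \<subseteq> tup (entries (\<rho>(x := n)) (n # sc) (Suc n) \<phi>) \<beta>"
    if "\<beta> \<in> snd ` set (entries (\<rho>(x := n)) (n # sc) (Suc n) \<phi>)" for \<beta>
    using that by (force simp: tup_def)
  have "(\<exists>f. \<forall>p\<in>X. fsat M (DEx x \<phi>) f (fst p \<circ> \<rho>) (snd p \<circ> \<sigma>)) \<longleftrightarrow>
      (\<exists>f H. \<forall>p\<in>X. H p \<in> univ M \<and> fsat M \<phi> f ((fst p \<circ> \<rho>)(x := H p)) (snd p \<circ> \<sigma>))"
    unfolding fsat.simps Bex_def bchoice_iff ..
  also have "\<dots> \<longleftrightarrow> (\<exists>H. (\<forall>p\<in>X. H p \<in> univ M) \<and>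
      (\<exists>f. \<forall>p\<in>X. fsat M \<phi> f ((fst p \<circ> \<rho>)(x := H p)) (snd p \<circ> \<sigma>)))"
    unfolding ball_conj_distrib by (rule iffI; elim exE conjE; intro exI conjI; assumption)
  also have "\<dots> \<longleftrightarrow> (\<forall>p\<in>X. \<exists>a\<in>univ M. \<exists>F. \<forall>g. range g \<subseteq> univ M \<longrightarrow>
      region M (\<rho>(x := n)) \<sigma> (n # sc) (Suc n) \<phi> F ((fst p)(n := a)) (snd p) g)"
    unfolding IH by (rule choose_existential[OF sep _ cover]) (use sc in auto)
  also have "\<dots> \<longleftrightarrow> (\<exists>F. \<forall>p\<in>X. \<forall>g. range g \<subseteq> univ M \<longrightarrow>
      region M \<rho> \<sigma> sc n (DEx x \<phi>) F (fst p) (snd p) g)"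
    unfolding region_DEx[OF \<rho> \<sigma> sc] by (simp add: ex_range_subset[OF ne])
  finally show ?case .
next
  case (DExB \<alpha> \<phi>)
  note \<rho> = DExB.prems(3) and \<sigma> = DExB.prems(4) and sc = DExB.prems(5) and sep = DExB.prems(6)
  have fresh: "\<sigma> y \<noteq> n" for y using \<sigma>[rule_format, of y] by simp
  have IH: "(\<exists>f. \<forall>p\<in>X. fsat M \<phi> f (fst p \<circ> \<rho>) ((snd p \<circ> \<sigma>)(\<alpha> := H p))) \<longleftrightarrow>
    (\<exists>F. \<forall>p\<in>X. \<forall>g. range g \<subseteq> univ M \<longrightarrow>
      region M \<rho> (\<sigma>(\<alpha> := n)) sc (Suc n) \<phi> F (fst p) ((snd p)(n := H p)) g)" for H
  proof -
    let ?Y = "(\<lambda>p. (fst p, (snd p)(n := H p))) ` X"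
    have "separates (set sc \<union> {}) ?Y"
      by (rule separates_image[OF sep, where \<pi> = id]) auto
    then have "(\<exists>f. \<forall>p\<in>?Y. fsat M \<phi> f (fst p \<circ> \<rho>) (snd p \<circ> \<sigma>(\<alpha> := n))) \<longleftrightarrow>
      (\<exists>F. \<forall>p\<in>?Y. \<forall>g. range g \<subseteq> univ M \<longrightarrow>
        region M \<rho> (\<sigma>(\<alpha> := n)) sc (Suc n) \<phi> F (fst p) (snd p) g)"
      using DExB.prems by (intro DExB.IH[of \<Gamma>]) (auto simp: less_SucI)
    then show ?thesis by (simp add: fun_upd_comp_fresh[OF fresh])
  qed
  have "(\<exists>f. \<forall>p\<in>X. fsat M (DExB \<alpha> \<phi>) f (fst p \<circ> \<rho>) (snd p \<circ> \<sigma>)) \<longleftrightarrow>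
      (\<exists>H f. \<forall>p\<in>X. fsat M \<phi> f (fst p \<circ> \<rho>) ((snd p \<circ> \<sigma>)(\<alpha> := H p)))"
    unfolding fsat.simps bchoice_iff by (rule ex_comm)
  also have "\<dots> \<longleftrightarrow> (\<exists>F. \<forall>p\<in>X. \<forall>g. range g \<subseteq> univ M \<longrightarrow> region M \<rho> (\<sigma>(\<alpha> := n)) sc (Suc n) \<phi> F
      (fst p) ((snd p)(n := F n (restrict (fst p) (set sc)))) g)" (is "?L \<longleftrightarrow> ?R")
    unfolding IH
  proof
    assume ?R
    then obtain F where "\<forall>p\<in>X. \<forall>g. range g \<subseteq> univ M \<longrightarrow> region M \<rho> (\<sigma>(\<alpha> := n)) sc (Suc n) \<phi> F
      (fst p) ((snd p)(n := F n (restrict (fst p) (set sc)))) g" ..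
    then show "\<exists>H F. \<forall>p\<in>X. \<forall>g. range g \<subseteq> univ M \<longrightarrow>
      region M \<rho> (\<sigma>(\<alpha> := n)) sc (Suc n) \<phi> F (fst p) ((snd p)(n := H p)) g"
      by (intro exI[of _ "\<lambda>p. F n (restrict (fst p) (set sc))"] exI[of _ F])
  next
    assume "\<exists>H F. \<forall>p\<in>X. \<forall>g. range g \<subseteq> univ M \<longrightarrow>
      region M \<rho> (\<sigma>(\<alpha> := n)) sc (Suc n) \<phi> F (fst p) ((snd p)(n := H p)) g"
    then obtain H F where F: "\<forall>p\<in>X. \<forall>g. range g \<subseteq> univ M \<longrightarrow>
      region M \<rho> (\<sigma>(\<alpha> := n)) sc (Suc n) \<phi> F (fst p) ((snd p)(n := H p)) g" by (elim exE)
    \<comment> \<open>Two members that agree on the scope are equal, so any choice \<open>H\<close>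
      per member is a function of the scope: the required Skolem function.\<close>
    have "\<forall>p\<in>X. \<forall>q\<in>X. (\<forall>x\<in>set sc. fst p x = fst q x) \<longrightarrow> H p = H q"
      using sep unfolding separates_def by blast
    then obtain h where h: "\<forall>p\<in>X. H p = h (restrict (fst p) (set sc))"
      unfolding dependence_function ..
    have "region M \<rho> (\<sigma>(\<alpha> := n)) sc (Suc n) \<phi> (F(n := h)) v b g \<longleftrightarrow>
        region M \<rho> (\<sigma>(\<alpha> := n)) sc (Suc n) \<phi> F v b g" for v b g
      by (rule region_cong) simp_all
    then show ?R using F h by (intro exI[of _ "F(n := h)"]) simp
  qed
  finally show ?case unfolding region_DExB[OF \<rho> \<sigma> sc] .
qed (simp_all add: region_def bext_def ex_range_subset[OF ne])

section \<open>Sentences\<close>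

text \<open>Under the empty assignment every variable has the same unspecified value
  \<open>the None\<close>, so renaming is invisible.\<close>

lemma fo_val_empty_comp [simp]: "fo_val empty_assignment \<circ> \<rho> = fo_val empty_assignment"
  by (simp add: fo_val_def empty_assignment_def comp_def fun_eq_iff)

lemma bool_val_empty_comp [simp]:
  "bool_val (empty_assignment :: 'a assignment) \<circ> \<sigma> = bool_val (empty_assignment :: 'a assignment)"
  by (simp add: bool_val_def empty_assignment_def comp_def fun_eq_iff)

lemma separates_singleton: "separates S {p}"
  by (simp add: separates_def)

lemma bbd_to_poc:
  fixes \<tau> :: "'r vocabulary"
  assumes "bbd_sentence \<tau> \<phi>"
  obtains \<psi> where "poc_sentence \<tau> \<psi>"
    and "\<And>M :: ('r, 'a) struct. is_structure \<tau> M \<Longrightarrow> bd_true M \<phi> \<longleftrightarrow> poc_true M \<psi>"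
proof -
  define \<rho> :: "nat \<Rightarrow> nat" where "\<rho> = (\<lambda>_. 0)"
  \<comment> \<open>Fresh names start at 2: 0 is the image of all variables not in scope, of both
    kinds, and 1 is the Boolean variable of the dummy entry in the outermost connective.\<close>
  define E where "E = entries \<rho> [] (Suc 1) \<phi>"
  define \<psi> where "\<psi> = PPoc (block 1 (width \<phi>) E) (matrix \<rho> \<rho> [] (Suc 1) \<phi>)"
  have wf: "bd_formula \<tau> \<phi>" and bounded: "bounded [] \<phi>"
    and free: "bd_free_fo \<phi> = {}" "bd_free_bool \<phi> = {}"
    using assms by (auto simp: bbd_sentence_def bbd_formula_def bd_sentence_def)
  have \<rho>: "\<forall>y. \<rho> y \<le> 1" "\<forall>y. \<rho> y < 1" "\<forall>y. \<rho> y < Suc 1" by (auto simp: \<rho>_def)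
  have "set (concat (map fst (block 1 (width \<phi>) E))) = {Suc 1..<Suc 1 + width \<phi>}"
    unfolding E_def by (rule block_fovars[OF \<rho>(1)]) simp
  moreover have "poc_free_fo (matrix \<rho> \<rho> [] (Suc 1) \<phi>) \<subseteq> {Suc 1..<Suc 1 + width \<phi>}"
    using poc_free_fo_matrix[of \<rho> \<rho> "[]" "Suc 1" \<phi>] by (simp only: free image_empty Un_empty_left)
  ultimately have "poc_free_fo \<psi> = {}" unfolding \<psi>_def poc_free_fo.simps by blast
  moreover have "poc_free_bool \<psi> = {}"
    using poc_free_bool_matrix[of \<rho> \<rho> "[]" "Suc 1" \<phi>]
    unfolding \<psi>_def E_def poc_free_bool.simps set_map block_bvars free image_empty Un_empty_left by blast
  moreover have "poc_formula \<tau> \<psi>"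
    unfolding \<psi>_def poc_formula.simps E_def
    by (intro conjI distinct_block poc_formula_matrix wf) (simp add: block_def)
  ultimately have "poc_sentence \<tau> \<psi>" by (simp add: poc_sentence_def)
  moreover have "bd_true M \<phi> \<longleftrightarrow> poc_true M \<psi>" if "is_structure \<tau> M" for M :: "('r, 'a) struct"
  proof -
    have ne: "univ M \<noteq> {}" using that by (simp add: is_structure_def)
    let ?v = "fo_val empty_assignment :: nat \<Rightarrow> 'a" and ?b = "bool_val (empty_assignment :: 'a assignment)"
    have "bd_true M \<phi> \<longleftrightarrow> (\<exists>f. \<forall>p\<in>{(?v, ?b)}. fsat M \<phi> f (fst p \<circ> \<rho>) (snd p \<circ> \<rho>))"
      by (simp add: bd_true_def bd_sat_iff_fsat)
    also have "\<dots> \<longleftrightarrow> (\<exists>F. \<forall>p\<in>{(?v, ?b)}. \<forall>g. range g \<subseteq> univ M \<longrightarrow>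
        region M \<rho> \<rho> [] (Suc 1) \<phi> F (fst p) (snd p) g)"
      by (rule matrix_correct[OF ne bounded _ \<rho>(3) \<rho>(3) _ separates_singleton]) simp_all
    also have "\<dots> \<longleftrightarrow> psat M \<psi> ?v ?b"
      unfolding \<psi>_def E_def by (subst psat_block[OF \<rho>(1) _ \<rho>(2)]) simp_all
    also have "\<dots> \<longleftrightarrow> poc_true M \<psi>"
      unfolding poc_true_def by (rule poc_sat_iff_psat[OF ne \<open>poc_formula \<tau> \<psi>\<close>, symmetric])
    finally show ?thesis .
  qed
  ultimately show thesis by (rule that)
qed

lemma poc_to_bbd:
  fixes \<tau> :: "'r vocabulary"
  assumes "poc_sentence \<tau> \<psi>"
  obtains \<phi> where "bbd_sentence \<tau> \<phi>"
    and "\<And>M :: ('r, 'a) struct. is_structure \<tau> M \<Longrightarrow> bd_true M \<phi> \<longleftrightarrow> poc_true M \<psi>"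
proof -
  define \<rho> :: "nat \<Rightarrow> nat" where "\<rho> = (\<lambda>_. 0)"
  \<comment> \<open>At level 1 no name is in scope; the initial team has a single member and is
    separated by the empty set of names.\<close>
  define \<phi> where "\<phi> = bd_of_poc 1 \<rho> \<psi>"
  have wf: "poc_formula \<tau> \<psi>" and free: "poc_free_fo \<psi> = {}" "poc_free_bool \<psi> = {}"
    using assms by (auto simp: poc_sentence_def)
  have "bd_formula \<tau> \<phi>" unfolding \<phi>_def by (rule bd_formula_bd_of_poc[OF wf])
  moreover have "bd_free_fo \<phi> = {}"
    using bd_free_fo_bd_of_poc[of 1 \<rho> \<psi>] by (simp add: \<phi>_def free)
  moreover have "bd_free_bool \<phi> = {}" by (simp add: \<phi>_def bd_free_bool_bd_of_poc free)
  moreover have "bounded [] \<phi>" using bounded_bd_of_poc[of 1 \<rho> \<psi>] by (simp add: \<phi>_def)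
  ultimately have "bbd_sentence \<tau> \<phi>"
    by (simp add: bbd_sentence_def bbd_formula_def bd_sentence_def)
  moreover have "bd_true M \<phi> \<longleftrightarrow> poc_true M \<psi>" if "is_structure \<tau> M" for M :: "('r, 'a) struct"
  proof -
    have ne: "univ M \<noteq> {}" using that by (simp add: is_structure_def)
    let ?v = "fo_val empty_assignment :: nat \<Rightarrow> 'a" and ?b = "bool_val (empty_assignment :: 'a assignment)"
    have "bd_true M \<phi> \<longleftrightarrow> tsat M \<phi> {(?v, ?b)}"
      by (simp add: bd_true_def bd_sat_iff_fsat tsat_def)
    also have "\<dots> \<longleftrightarrow> (\<forall>p\<in>{(?v, ?b)}. psat M \<psi> (fst p \<circ> \<rho>) (snd p))"
      unfolding \<phi>_def
      by (rule bd_of_poc_correct[OF ne _ _ wf separates_singleton]) (simp_all add: \<rho>_def)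
    also have "\<dots> \<longleftrightarrow> poc_true M \<psi>"
      by (simp add: poc_true_def poc_sat_iff_psat[OF ne wf])
    finally show ?thesis .
  qed
  ultimately show thesis by (rule that)
qed

theorem theorem6p2:
  fixes \<tau> :: "'r vocabulary"
  shows "(\<forall>\<phi>. bbd_sentence \<tau> \<phi> \<longrightarrow>
            (\<exists>\<psi>. poc_sentence \<tau> \<psi> \<and>
               (\<forall>M :: ('r, 'a) struct. is_structure \<tau> M \<longrightarrow> (bd_true M \<phi> \<longleftrightarrow> poc_true M \<psi>)))) \<and>
         (\<forall>\<psi>. poc_sentence \<tau> \<psi> \<longrightarrow>
            (\<exists>\<phi>. bbd_sentence \<tau> \<phi> \<and>
               (\<forall>M :: ('r, 'a) struct. is_structure \<tau> M \<longrightarrow> (bd_true M \<phi> \<longleftrightarrow> poc_true M \<psi>))))"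
proof (intro conjI allI impI)
  fix \<phi> assume "bbd_sentence \<tau> \<phi>"
  then show "\<exists>\<psi>. poc_sentence \<tau> \<psi> \<and>
      (\<forall>M :: ('r, 'a) struct. is_structure \<tau> M \<longrightarrow> (bd_true M \<phi> \<longleftrightarrow> poc_true M \<psi>))"
    using bbd_to_poc by blast
next
  fix \<psi> assume "poc_sentence \<tau> \<psi>"
  then show "\<exists>\<phi>. bbd_sentence \<tau> \<phi> \<and>
      (\<forall>M :: ('r, 'a) struct. is_structure \<tau> M \<longrightarrow> (bd_true M \<phi> \<longleftrightarrow> poc_true M \<psi>))"
    using poc_to_bbd by blast
qed

end
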